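(* Let $E/\mathbb{Q}$ be a Serre curve and let $m \geq 2$ be any positive integer. Then $C_E^{m\text{-div}} > 1/m$.
   Context: For an elliptic curve $E/\mathbb{Q}$ of conductor $N_E$, given by $Y^2=X^3+aX+b$ with $a,b\in\mathbb{Z}$ and $\Delta_E=-16(4a^3+27b^2)\ne 0$, let $\rho_E:\mathrm{Gal}(\overline{\mathbb{Q}}/\mathbb{Q})\to \mathrm{GL}_2(\widehat{\mathbb{Z}})$ be the adelic Galois representation given by the action on all torsion points (after a choice of basis of the Tate module), $G_E$ its image, and $G_E(n)\subseteq \mathrm{GL}_2(\mathbb{Z}/n\mathbb{Z})$ the reduction of $G_E$ modulo $n$. Serre curve: suppose $\Delta_E$ is not a square. Let $d_E$ be the least positive integer with $\mathbb{Q}(\sqrt{\Delta_E})\subseteq\mathbb{Q}(\zeta_{d_E})$, and let $\alpha:(\mathbb{Z}/d_E\mathbb{Z})^\times\to\{\pm1\}$ be the quadratic character with $\sigma(\sqrt{\Delta_E})=\alpha(\chi_{d_E}(\sigma))\sqrt{\Delta_E}$ for all $\sigma\in\mathrm{Gal}(\overline{\mathbb{Q}}/\mathbb{Q})$, where $\chi_{d_E}$ is the mod $d_E$ cyclotomic character. Let $\epsilon:\mathrm{GL}_2(\mathbb{Z}/2\mathbb{Z})\simeq S_3\to\{\pm1\}$ be the sign character. Put $H_E=\{M\in\mathrm{GL}_2(\widehat{\mathbb{Z}}):\epsilon(M \bmod 2)=\alpha(\det M \bmod d_E)\}$; one always has $G_E\subseteq H_E$. A Serre curve is a non-CM elliptic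 curve $E/\mathbb{Q}$ with $G_E=H_E$. $C_E^{m\text{-div}}$ denotes the natural density, among primes, of primes $p\nmid N_E$ with $m\mid \#E_p(\mathbb{F}_p)$, where $E_p$ is the reduction of $E$ mod $p$; equivalently $C_E^{m\text{-div}}=|G_E(m)\cap\Psi(m)|/|G_E(m)|$, where $\Psi(m)=\{M\in\mathrm{GL}_2(\mathbb{Z}/m\mathbb{Z}):\det(I-M)\equiv0\pmod m\}$. *)

theory Defs
  imports "HOL-Analysis.Analysis" "HOL-Combinatorics.Permutations"
    "HOL-Computational_Algebra.Polynomial" "HOL-Number_Theory.Cong"
begin

section \<open>The field of algebraic numbers and its automorphisms\<close>

definition Qbar :: "complex set" where
  "Qbar = {z. algebraic z}"

text \<open>Automorphisms are extensional functions on \<^term>\<open>Qbar\<close>, so that each one is represented once.\<close>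

definition Gal_Q :: "(complex \<Rightarrow> complex) set" where
  "Gal_Q = {\<sigma>. \<sigma> \<in> extensional Qbar \<and> bij_betw \<sigma> Qbar Qbar \<and>
     (\<forall>x\<in>Qbar. \<forall>y\<in>Qbar. \<sigma> (x + y) = \<sigma> x + \<sigma> y \<and> \<sigma> (x * y) = \<sigma> x * \<sigma> y) \<and>
     (\<forall>q\<in>\<rat>. \<sigma> q = q)}"

text \<open>The field \<open>\<rat>(z)\<close>; since \<open>inverse 0 = 0\<close>, closure under \<^const>\<open>inverse\<close> needs no side condition.\<close>

definition rat_adjoin :: "complex \<Rightarrow> complex set" where
  "rat_adjoin z = \<Inter> {K. \<rat> \<subseteq> K \<and> z \<in> K \<and>
     (\<forall>x\<in>K. \<forall>y\<in>K. x + y \<in> K \<and> x * y \<in> K) \<and> (\<forall>x\<in>K. - x \<in> K \<and> inverse x \<in> K)}"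

definition root_of_unity :: "nat \<Rightarrow> complex" where
  "root_of_unity d = cis (2 * pi / real d)"

definition cyclotomic_char :: "nat \<Rightarrow> (complex \<Rightarrow> complex) \<Rightarrow> nat" where
  "cyclotomic_char d \<sigma> = (THE k. k < d \<and> \<sigma> (root_of_unity d) = root_of_unity d ^ k)"


section \<open>Elliptic curves in short Weierstrass form\<close>

definition ec_disc :: "int \<Rightarrow> int \<Rightarrow> int" where
  "ec_disc a b = - 16 * (4 * a ^ 3 + 27 * b ^ 2)"

definition elliptic_curve :: "int \<Rightarrow> int \<Rightarrow> bool" where
  "elliptic_curve a b \<longleftrightarrow> ec_disc a b \<noteq> 0"

datatype ec_point = Infinity | Affine complex complex

definition ec_points :: "int \<Rightarrow> int \<Rightarrow> ec_point set" where
  "ec_points a b = insert Infinity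
     {Affine x y | x y. x \<in> Qbar \<and> y \<in> Qbar \<and> y ^ 2 = x ^ 3 + of_int a * x + of_int b}"

fun ec_neg :: "ec_point \<Rightarrow> ec_point" where
  "ec_neg Infinity = Infinity"
| "ec_neg (Affine x y) = Affine x (- y)"

text \<open>Chord and tangent law; the coefficient \<open>b\<close> does not enter the formulas.\<close>

fun ec_add :: "int \<Rightarrow> ec_point \<Rightarrow> ec_point \<Rightarrow> ec_point" where
  "ec_add a Infinity Q = Q"
| "ec_add a P Infinity = P"
| "ec_add a (Affine x1 y1) (Affine x2 y2) =
     (if x1 = x2 \<and> y1 = - y2 then Infinity
      else let l = (if x1 = x2 then (3 * x1 ^ 2 + of_int a) / (2 * y1)
                    else (y2 - y1) / (x2 - x1));
               x3 = l ^ 2 - x1 - x2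
           in Affine x3 (l * (x1 - x3) - y1))"

definition ec_mult :: "int \<Rightarrow> int \<Rightarrow> ec_point \<Rightarrow> ec_point" where
  "ec_mult a n P =
     (if n \<ge> 0 then (ec_add a P ^^ nat n) Infinity else ec_neg ((ec_add a P ^^ nat (- n)) Infinity))"

definition ec_torsion :: "int \<Rightarrow> int \<Rightarrow> nat \<Rightarrow> ec_point set" where
  "ec_torsion a b n = {P \<in> ec_points a b. ec_mult a (int n) P = Infinity}"

fun ec_gal :: "(complex \<Rightarrow> complex) \<Rightarrow> ec_point \<Rightarrow> ec_point" where
  "ec_gal \<sigma> Infinity = Infinity"
| "ec_gal \<sigma> (Affine x y) = Affine (\<sigma> x) (\<sigma> y)"


section \<open>Complex multiplication\<close>

definition Qbar_poly2 :: "complex poly poly set" where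
  "Qbar_poly2 = {p. \<forall>i j. coeff (coeff p i) j \<in> Qbar}"

definition eval2 :: "complex poly poly \<Rightarrow> complex \<Rightarrow> complex \<Rightarrow> complex" where
  "eval2 p x y = poly (poly p [:y:]) x"

text \<open>
  An endomorphism is a group homomorphism given by rational functions over \<^term>\<open>Qbar\<close>.
  It suffices to ask for this away from finitely many points: a homomorphism that agrees with
  a morphism of curves at all but finitely many points agrees with it everywhere.
\<close>

definition ec_endomorphism :: "int \<Rightarrow> int \<Rightarrow> (ec_point \<Rightarrow> ec_point) \<Rightarrow> bool" where
  "ec_endomorphism a b \<phi> \<longleftrightarrow>
     (\<forall>P\<in>ec_points a b. \<phi> P \<in> ec_points a b) \<and>
     (\<forall>P\<in>ec_points a b. \<forall>Q\<in>ec_points a b. \<phi> (ec_add a P Q) = ec_add a (\<phi> P) (\<phi> Q)) \<and>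
     ((\<forall>P\<in>ec_points a b. \<phi> P = Infinity) \<or>
      (\<exists>p\<in>Qbar_poly2. \<exists>q\<in>Qbar_poly2. \<exists>r\<in>Qbar_poly2. \<exists>s\<in>Qbar_poly2.
         finite {P \<in> ec_points a b.
           \<not> (\<exists>x y. P = Affine x y \<and> eval2 q x y \<noteq> 0 \<and> eval2 s x y \<noteq> 0 \<and>
                \<phi> P = Affine (eval2 p x y / eval2 q x y) (eval2 r x y / eval2 s x y))}))"

definition has_CM :: "int \<Rightarrow> int \<Rightarrow> bool" where
  "has_CM a b \<longleftrightarrow>
     (\<exists>\<phi>. ec_endomorphism a b \<phi> \<and> \<not> (\<exists>n. \<forall>P\<in>ec_points a b. \<phi> P = ec_mult a n P))"


section \<open>General linear groups over \<open>\<int>/n\<int>\<close> and over the profinite integers\<close>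

text \<open>Residue classes modulo \<open>n\<close> are represented by the integers in \<open>{0..<n}\<close>.\<close>

definition residue_mat :: "nat \<Rightarrow> (int ^ 2 ^ 2) set" where
  "residue_mat n = {M. \<forall>i j. M $ i $ j \<in> {0..<int n}}"

definition GL2 :: "nat \<Rightarrow> (int ^ 2 ^ 2) set" where
  "GL2 n = {M \<in> residue_mat n. coprime (det M) (int n)}"

text \<open>The inverse limit of the groups \<^term>\<open>GL2 n\<close>, ordered by divisibility.\<close>

definition GL2_Zhat :: "(nat \<Rightarrow> int ^ 2 ^ 2) set" where
  "GL2_Zhat = {M \<in> (\<Pi>\<^sub>E n\<in>{0<..}. GL2 n).
     \<forall>n>0. \<forall>k>0. n dvd k \<longrightarrow> (\<forall>i j. [M k $ i $ j = M n $ i $ j] (mod int n))}"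

definition reduce_mod :: "nat \<Rightarrow> (nat \<Rightarrow> int ^ 2 ^ 2) set \<Rightarrow> (int ^ 2 ^ 2) set" where
  "reduce_mod n G = (\<lambda>M. M n) ` G"

definition nonzero_vecs2 :: "(int ^ 2) set" where
  "nonzero_vecs2 = {v. (\<forall>i. v $ i \<in> {0, 1}) \<and> v \<noteq> 0}"

text \<open>
  The isomorphism of \<open>GL\<^sub>2(\<int>/2\<int>)\<close> with the symmetric group on three letters is the action on
  the three nonzero vectors; the sign does not depend on the choice of isomorphism.
\<close>

definition GL2_sign :: "int ^ 2 ^ 2 \<Rightarrow> int" where
  "GL2_sign M =
     sign (\<lambda>v. if v \<in> nonzero_vecs2 then (\<chi> i. (M *v v) $ i mod 2) else v)"


section \<open>The adelic Galois representation\<close>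

text \<open>
  A basis of the adelic Tate module: for every \<open>n > 0\<close> a pair \<open>e n\<close> that is a
  \<open>\<int>/n\<int>\<close>-basis of the \<open>n\<close>-torsion, compatible under the multiplication maps.
\<close>

definition torsion_basis :: "int \<Rightarrow> int \<Rightarrow> nat \<Rightarrow> ec_point \<times> ec_point \<Rightarrow> bool" where
  "torsion_basis a b n B \<longleftrightarrow>
     fst B \<in> ec_torsion a b n \<and> snd B \<in> ec_torsion a b n \<and>
     (\<forall>T\<in>ec_torsion a b n. \<exists>!(x, y). x \<in> {0..<int n} \<and> y \<in> {0..<int n} \<and>
        T = ec_add a (ec_mult a x (fst B)) (ec_mult a y (snd B)))"

definition tate_basis :: "int \<Rightarrow> int \<Rightarrow> (nat \<Rightarrow> ec_point \<times> ec_point) \<Rightarrow> bool" where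
  "tate_basis a b e \<longleftrightarrow>
     (\<forall>n>0. torsion_basis a b n (e n)) \<and>
     (\<forall>n>0. \<forall>k>0. n dvd k \<longrightarrow>
        ec_mult a (int (k div n)) (fst (e k)) = fst (e n) \<and>
        ec_mult a (int (k div n)) (snd (e k)) = snd (e n))"

text \<open>The columns of the matrix are the coordinates of the images of the basis points.\<close>

definition galois_matrix ::
  "int \<Rightarrow> (nat \<Rightarrow> ec_point \<times> ec_point) \<Rightarrow> (complex \<Rightarrow> complex) \<Rightarrow> nat \<Rightarrow> int ^ 2 ^ 2" where
  "galois_matrix a e \<sigma> n = (THE M. M \<in> residue_mat n \<and>
     ec_gal \<sigma> (fst (e n)) =
       ec_add a (ec_mult a (M $ 1 $ 1) (fst (e n))) (ec_mult a (M $ 2 $ 1) (snd (e n))) \<and>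
     ec_gal \<sigma> (snd (e n)) =
       ec_add a (ec_mult a (M $ 1 $ 2) (fst (e n))) (ec_mult a (M $ 2 $ 2) (snd (e n))))"

definition adelic_rep ::
  "int \<Rightarrow> (nat \<Rightarrow> ec_point \<times> ec_point) \<Rightarrow> (complex \<Rightarrow> complex) \<Rightarrow> nat \<Rightarrow> int ^ 2 ^ 2" where
  "adelic_rep a e \<sigma> = (\<lambda>n\<in>{0<..}. galois_matrix a e \<sigma> n)"

definition adelic_image :: "int \<Rightarrow> (nat \<Rightarrow> ec_point \<times> ec_point) \<Rightarrow> (nat \<Rightarrow> int ^ 2 ^ 2) set" where
  "adelic_image a e = adelic_rep a e ` Gal_Q"


section \<open>Serre curves\<close>

definition disc_conductor :: "int \<Rightarrow> int \<Rightarrow> nat" where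
  "disc_conductor a b =
     (LEAST d. d > 0 \<and> rat_adjoin (csqrt (of_int (ec_disc a b))) \<subseteq> rat_adjoin (root_of_unity d))"

text \<open>
  A quadratic character of \<open>(\<int>/d\<int>)\<^sup>\<times>\<close>, that is, one of order exactly two, as a \<open>d\<close>-periodic
  function on the integers; its values at integers not coprime to \<open>d\<close> play no role.
\<close>

definition quadratic_char :: "nat \<Rightarrow> (int \<Rightarrow> int) \<Rightarrow> bool" where
  "quadratic_char d \<alpha> \<longleftrightarrow> d > 0 \<and>
     (\<forall>x y. [x = y] (mod int d) \<longrightarrow> \<alpha> x = \<alpha> y) \<and>
     (\<forall>x. coprime x (int d) \<longrightarrow> \<alpha> x \<in> {1, -1}) \<and>
     (\<forall>x y. coprime x (int d) \<longrightarrow> coprime y (int d) \<longrightarrow> \<alpha> (x * y) = \<alpha> x * \<alpha> y) \<and>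
     (\<exists>x. coprime x (int d) \<and> \<alpha> x = -1)"

definition disc_char :: "int \<Rightarrow> int \<Rightarrow> (int \<Rightarrow> int) \<Rightarrow> bool" where
  "disc_char a b \<alpha> \<longleftrightarrow> quadratic_char (disc_conductor a b) \<alpha> \<and>
     (\<forall>\<sigma>\<in>Gal_Q. \<sigma> (csqrt (of_int (ec_disc a b))) =
        of_int (\<alpha> (int (cyclotomic_char (disc_conductor a b) \<sigma>))) * csqrt (of_int (ec_disc a b)))"

definition serre_subgroup :: "int \<Rightarrow> int \<Rightarrow> (int \<Rightarrow> int) \<Rightarrow> (nat \<Rightarrow> int ^ 2 ^ 2) set" where
  "serre_subgroup a b \<alpha> =
     {M \<in> GL2_Zhat. GL2_sign (M 2) = \<alpha> (det (M (disc_conductor a b)))}"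

text \<open>
  When the discriminant is not a square, there is exactly one \<open>\<alpha>\<close> with \<^term>\<open>disc_char a b \<alpha>\<close>
  up to values at integers not coprime to the conductor. The subgroup
  \<^term>\<open>serre_subgroup a b \<alpha>\<close> is normal, so the condition does not depend on the basis \<open>e\<close>.
\<close>

definition serre_curve :: "int \<Rightarrow> int \<Rightarrow> (nat \<Rightarrow> ec_point \<times> ec_point) \<Rightarrow> bool" where
  "serre_curve a b e \<longleftrightarrow>
     elliptic_curve a b \<and> \<not> has_CM a b \<and> \<not> (\<exists>r::rat. r ^ 2 = of_int (ec_disc a b)) \<and>
     (\<exists>\<alpha>. disc_char a b \<alpha> \<and> adelic_image a e = serre_subgroup a b \<alpha>)"


section \<open>The density of primes \<open>p\<close> with \<open>m\<close> dividing the order of \<open>E\<^sub>p(\<bbbF>\<^sub>p)\<close>\<close>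

definition Psi :: "nat \<Rightarrow> (int ^ 2 ^ 2) set" where
  "Psi m = {M \<in> GL2 m. [det (mat 1 - M) = 0] (mod int m)}"

text \<open>
  By the Chebotarev density theorem, the natural density is the proportion of elements of the
  mod \<open>m\<close> image of Galois lying in \<^term>\<open>Psi m\<close>; this proportion is taken as the definition.
\<close>

definition C_mdiv :: "int \<Rightarrow> (nat \<Rightarrow> ec_point \<times> ec_point) \<Rightarrow> nat \<Rightarrow> real" where
  "C_mdiv a e m =
     real (card (reduce_mod m (adelic_image a e) \<inter> Psi m)) /
     real (card (reduce_mod m (adelic_image a e)))"

end

theory Submission
  imports Defs
begin

text \<open>
  The image \<open>H(m)\<close> of the Galois representation modulo \<open>m\<close> is either all of \<open>GL\<^sub>2(\<int>/m\<int>)\<close> or,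
  for some even \<open>m\<close>, the subgroup where the sign modulo 2 equals a nontrivial quadratic character
  \<open>\<beta>\<close> of the determinant modulo \<open>m\<close>. Either way the estimate is obtained one determinant at
  a time.

  Fix a unit \<open>u\<close>. A matrix of determinant \<open>u\<close> satisfies \<open>det (I - M) = 0\<close> exactly when its trace
  is \<open>1 + u\<close>; writing its upper left entry as \<open>1 + x\<close> and its off-diagonal entries as \<open>b, c\<close>,
  the condition becomes \<open>b c = x (v - x)\<close> with \<open>v = u - 1\<close>. For each \<open>b\<close>, the
  solutions with \<open>x\<close> a multiple of \<open>g = gcd b m\<close> already number \<open>m\<close>: there are \<open>m / g\<close> such \<open>x\<close>, and
  \<open>g\<close> values of \<open>c\<close> for each. So there are at least \<open>m\<^sup>2\<close> solutions (\<open>card_quadric_ge\<close>). On the other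
  hand there are fewer than \<open>m\<^sup>3\<close> matrices of determinant \<open>u\<close> in all, because the first row determines
  the second up to \<open>m\<close> choices and the zero row is excluded (\<open>card_det_fiber_less\<close>). The ratio
  therefore exceeds \<open>1/m\<close>, which settles the case \<open>H(m) = GL\<^sub>2(\<int>/m\<int>)\<close>.

  In the index two case \<open>m\<close> and \<open>v\<close> are even, so the matrices being counted have even trace, and
  modulo 2 each is the identity or one of the three involutions. Hence its sign is \<open>1\<close> precisely when
  \<open>b\<close> and \<open>c\<close> are even. At least \<open>m\<^sup>2/4\<close> solutions are of this kind, and at least \<open>3m\<^sup>2/4\<close> are not
  (\<open>card_quadric_even_ge\<close>, \<open>card_quadric_odd_ge\<close>). As \<open>\<beta>\<close> is nontrivial, it takes both values
  equally often, so the average over \<open>u\<close> is at least \<open>(m\<^sup>2/4 + 3m\<^sup>2/4)/2 = m\<^sup>2/2\<close>. Since \<open>H(m)\<close> has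
  at most half the elements of \<open>GL\<^sub>2(\<int>/m\<int>)\<close>, the factor \<open>1/2\<close> cancels and the same comparison applies.

  The description of \<open>H(m)\<close> reduces to integer matrices. Any integer matrix whose determinant is
  coprime to \<open>N\<close> agrees modulo every divisor of \<open>N\<close> with an element of \<open>GL\<^sub>2\<close> of the profinite
  integers (\<open>adelic_lift\<close>). With \<open>N = 2 m d\<close>, \<open>d\<close> the modulus of the quadratic character \<open>\<alpha>\<close>,
  membership in \<open>H(m)\<close> thus only involves the character \<open>sign \<cdot> (\<alpha> \<circ> det)\<close> of
  \<open>GL\<^sub>2(\<int>/N\<int>)\<close>, and the two cases are whether or not it is trivial on the matrices that are the
  identity modulo \<open>m\<close>.
\<close>

section \<open>Points on the quadric \<open>b c = x (v - x)\<close> modulo \<open>n\<close>\<close>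

definition quadric_fiber :: "int \<Rightarrow> int \<Rightarrow> int \<Rightarrow> (int \<times> int) set" where
  "quadric_fiber n v b = {(x, c). x \<in> {0..<n} \<and> c \<in> {0..<n} \<and> [b * c = x * (v - x)] (mod n)}"

definition quadric :: "int \<Rightarrow> int \<Rightarrow> (int \<times> int \<times> int) set" where
  "quadric n v = (SIGMA b:{0..<n}. quadric_fiber n v b)"

lemma finite_quadric_fiber: "finite (quadric_fiber n v b)"
  by (rule finite_subset[of _ "{0..<n} \<times> {0..<n}"]) (auto simp: quadric_fiber_def)

lemma finite_quadric: "finite (quadric n v)"
  by (simp add: quadric_def finite_quadric_fiber)

text \<open>
  If \<open>x = s g i\<close> is a multiple of \<open>g = gcd b n\<close>, the congruence \<open>b c = x (v - x)\<close> is
  solvable for \<open>c\<close>, and its solutions form a coset of the \<open>g\<close>-element annihilator of \<open>b\<close>. There are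
  \<open>n / (s g)\<close> such \<open>x\<close>, hence \<open>n / s\<close> pairs. The parameter \<open>s\<close> allows counting only those
  pairs with \<open>x\<close> even.
\<close>

lemma card_quadric_fiber_ge:
  fixes n v b s :: int
  assumes n: "n > 0" and s: "s > 0" and dvd: "s * gcd b n dvd n"
  shows "n \<le> s * int (card {(x, c) \<in> quadric_fiber n v b. s dvd x})"
proof -
  define g where "g = gcd b n"
  have g: "g > 0" using n by (simp add: g_def)
  obtain k where k: "n = s * g * k" using dvd unfolding g_def by blast
  have kpos: "k > 0" by (rule zero_less_mult_pos[of "s * g"]) (use n s g k in auto)
  obtain r t where rt: "r * b + t * n = g" using bezout_int[of b n] unfolding g_def by blast
  obtain b' where b': "b = g * b'" unfolding g_def by (metis dvd_def gcd_dvd1)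
  \<comment> \<open>The Bezout identity makes \<open>r s i (v - s g i)\<close> a solution \<open>c\<close>; multiples of \<open>n / g = s k\<close> are annihilated by \<open>b\<close>.\<close>
  define f where "f = (\<lambda>(i, j). (s * g * i, (r * s * i * (v - s * g * i) + j * (s * k)) mod n))"
  have "f ` ({0..<k} \<times> {0..<g}) \<subseteq> {(x, c) \<in> quadric_fiber n v b. s dvd x}"
  proof safe
    fix i j x c assume ij: "i \<in> {0..<k}" "j \<in> {0..<g}" and f: "(x, c) = f (i, j)"
    let ?x = "s * g * i"
    have "?x < n" unfolding k using ij s g by (simp add: mult_strict_left_mono)
    have "b * (r * s * i * (v - ?x) + j * (s * k)) - ?x * (v - ?x) = n * (b' * j - t * s * i * (v - ?x))"
    proof -
      have "b * (j * (s * k)) = n * (b' * j)" by (simp add: b' k)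
      moreover have "b * r * (s * i * (v - ?x)) - g * (s * i * (v - ?x)) = - (t * n) * (s * i * (v - ?x))"
        using arg_cong[OF rt, of "\<lambda>z. z * (s * i * (v - ?x))"] by (simp add: algebra_simps)
      ultimately show ?thesis by (simp add: algebra_simps)
    qed
    then have "[b * (r * s * i * (v - ?x) + j * (s * k)) = ?x * (v - ?x)] (mod n)"
      by (metis cong_iff_dvd_diff dvd_triv_left)
    then have "[b * ((r * s * i * (v - ?x) + j * (s * k)) mod n) = ?x * (v - ?x)] (mod n)"
      by (simp add: cong_def mod_mult_right_eq)
    with f ij \<open>?x < n\<close> n s g show "(x, c) \<in> quadric_fiber n v b" "s dvd x"
      by (auto simp: f_def quadric_fiber_def)
  qed
  moreover have "inj_on f ({0..<k} \<times> {0..<g})"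
  proof (rule inj_onI, clarify)
    fix i j i' j' assume ij: "j \<in> {0..<g}" "j' \<in> {0..<g}" and eq: "f (i, j) = f (i', j')"
    have i: "i = i'" using eq s g by (simp add: f_def)
    have "[r * s * i * (v - s * g * i) + j * (s * k) = r * s * i * (v - s * g * i) + j' * (s * k)] (mod n)"
      using eq i by (simp add: f_def cong_def)
    then have "[j * (s * k) = j' * (s * k)] (mod n)" by (simp add: cong_add_lcancel)
    then have "s * k * g dvd s * k * (j - j')"
      by (simp add: cong_iff_dvd_diff k algebra_simps)
    then have "g dvd j - j'" using s kpos by simp
    then have "j = j'" using ij by (metis atLeastLessThan_iff cong_iff_dvd_diff cong_less_imp_eq_int)
    with i show "i = i' \<and> j = j'" by simp
  qed
  moreover have "finite {(x, c) \<in> quadric_fiber n v b. s dvd x}"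
    by (rule finite_subset[OF _ finite_quadric_fiber[of n v b]]) auto
  ultimately have "card ({0..<k} \<times> {0..<g}) \<le> card {(x, c) \<in> quadric_fiber n v b. s dvd x}"
    by (meson card_inj_on_le)
  then have "nat k * nat g \<le> card {(x, c) \<in> quadric_fiber n v b. s dvd x}" by simp
  then have "k * g \<le> int (card {(x, c) \<in> quadric_fiber n v b. s dvd x})"
    using kpos g by (simp flip: of_nat_mult add: nat_mult_distrib[symmetric] nat_le_iff)
  then show ?thesis using mult_left_mono[of "k * g" _ s] s by (simp add: k ac_simps)
qed

lemma card_quadric_ge:
  assumes "n > 0"
  shows "n\<^sup>2 \<le> int (card (quadric n v))"
proof -
  have "n \<le> int (card (quadric_fiber n v b))" for b
    using card_quadric_fiber_ge[of n 1 b v] assms by simp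
  then have "(\<Sum>b\<in>{0..<n}. n) \<le> (\<Sum>b\<in>{0..<n}. int (card (quadric_fiber n v b)))"
    by (intro sum_mono)
  with assms show ?thesis by (simp add: quadric_def finite_quadric_fiber power2_eq_square)
qed

definition quadric_even :: "int \<Rightarrow> int \<Rightarrow> (int \<times> int \<times> int) set" where
  "quadric_even n v = {(b, x, c) \<in> quadric n v. even b \<and> even c}"

definition quadric_odd :: "int \<Rightarrow> int \<Rightarrow> (int \<times> int \<times> int) set" where
  "quadric_odd n v = {(b, x, c) \<in> quadric n v. odd b \<or> odd c}"

text \<open>
  Doubling all coordinates maps the quadric modulo \<open>n / 2\<close> with parameter \<open>v / 2\<close> into the
  quadric modulo \<open>n\<close>.
\<close>

lemma card_quadric_even_ge:
  assumes "n > 0" "even n" "even v"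
  shows "n\<^sup>2 \<le> 4 * int (card (quadric_even n v))"
proof -
  obtain h w where h: "n = 2 * h" and w: "v = 2 * w" using assms by (meson evenE)
  define f :: "int \<times> int \<times> int \<Rightarrow> int \<times> int \<times> int" where "f = (\<lambda>(b, x, c). (2 * b, 2 * x, 2 * c))"
  have "f ` quadric h w \<subseteq> quadric_even n v"
  proof safe
    fix b x c b' x' c' assume *: "(b, x, c) = f (b', x', c')" "(b', x', c') \<in> quadric h w"
    then have "h dvd b' * c' - x' * (w - x')" by (simp add: quadric_def quadric_fiber_def cong_iff_dvd_diff)
    then have "2 * h dvd 2 * (2 * (b' * c' - x' * (w - x')))" by (intro mult_dvd_mono dvd_mult) auto
    then have "n dvd (2 * b') * (2 * c') - (2 * x') * (v - 2 * x')"
      by (simp add: h w algebra_simps)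
    with * show "(b, x, c) \<in> quadric_even n v"
      by (auto simp: f_def quadric_even_def quadric_def quadric_fiber_def cong_iff_dvd_diff h)
  qed
  moreover have "inj_on f (quadric h w)" by (auto simp: inj_on_def f_def)
  moreover have "finite (quadric_even n v)"
    by (rule finite_subset[OF _ finite_quadric[of n v]]) (auto simp: quadric_even_def)
  ultimately have "card (quadric h w) \<le> card (quadric_even n v)" by (meson card_inj_on_le)
  moreover have "h\<^sup>2 \<le> int (card (quadric h w))" using card_quadric_ge[of h w] assms h by simp
  ultimately show ?thesis by (simp add: h power2_eq_square)
qed

lemma card_odd_residues:
  assumes "n > 0" "even n"
  shows "2 * int (card {b \<in> {0..<n}. odd b}) = n"
proof -
  obtain h where h: "n = 2 * h" using assms by (auto elim: evenE)
  have "{b \<in> {0..<n}. odd b} = (\<lambda>i. 2 * i + 1) ` {0..<h}"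
    by (auto simp: h elim!: oddE)
  also have "card \<dots> = card {0..<h}" by (rule card_image) (auto simp: inj_on_def)
  finally show ?thesis using assms h by simp
qed

text \<open>
  For odd \<open>b\<close> the fibre over \<open>b\<close> has at least \<open>n\<close> points, and at least \<open>n / 2\<close> of them
  have \<open>x\<close> even, hence also \<open>c\<close> even. Summing over odd \<open>b\<close> gives \<open>n\<^sup>2/2\<close> points with \<open>b\<close> odd, and exchanging
  \<open>b\<close> and \<open>c\<close> in the second family gives \<open>n\<^sup>2/4\<close> points with \<open>b\<close> even and \<open>c\<close> odd.
\<close>

lemma card_quadric_odd_ge:
  assumes n: "n > 0" "even n" and v: "even v"
  shows "3 * n\<^sup>2 \<le> 4 * int (card (quadric_odd n v))"
proof -
  define B where "B = {b \<in> {0..<n}. odd b}"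
  have finB: "finite B" unfolding B_def by (rule finite_subset[of _ "{0..<n}"]) auto
  define F where "F = (SIGMA b:B. quadric_fiber n v b)"
  define G where "G = (SIGMA b:B. {(x, c) \<in> quadric_fiber n v b. 2 dvd x})"
  define swap :: "int \<times> int \<times> int \<Rightarrow> int \<times> int \<times> int" where "swap = (\<lambda>(b, x, c). (c, x, b))"
  have finfib: "finite {(x, c) \<in> quadric_fiber n v b. 2 dvd x}" for b
    by (rule finite_subset[OF _ finite_quadric_fiber[of n v b]]) auto
  have finF: "finite F" and finG: "finite G"
    by (auto simp: F_def G_def finB finfib finite_quadric_fiber)
  have cardB: "2 * int (card B) = n" unfolding B_def using n by (rule card_odd_residues)
  have "int (card F) = (\<Sum>b\<in>B. int (card (quadric_fiber n v b)))"
    by (simp add: F_def finB finite_quadric_fiber)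
  also have "\<dots> \<ge> (\<Sum>b\<in>B. n)"
    using card_quadric_fiber_ge[of n 1 _ v] n by (intro sum_mono) simp
  finally have "n * (2 * int (card B)) \<le> 2 * int (card F)" by (simp add: algebra_simps)
  then have cardF: "n * n \<le> 2 * int (card F)" by (simp only: cardB)
  have "2 * int (card G) = (\<Sum>b\<in>B. 2 * int (card {(x, c) \<in> quadric_fiber n v b. 2 dvd x}))"
    by (simp add: G_def finB finfib sum_distrib_left)
  also have "\<dots> \<ge> (\<Sum>b\<in>B. n)"
  proof (intro sum_mono card_quadric_fiber_ge)
    fix b assume "b \<in> B"
    then have "coprime 2 (gcd b n)" by (simp add: B_def)
    \<comment> \<open>The gcd is odd and \<open>n\<close> is even, so twice the gcd still divides \<open>n\<close>.\<close>
    then show "2 * gcd b n dvd n" using n by (simp add: divides_mult)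
  qed (use n in auto)
  finally have "n * (2 * int (card B)) \<le> 4 * int (card G)" by (simp add: algebra_simps)
  then have cardG: "n * n \<le> 4 * int (card G)" by (simp only: cardB)
  have cG: "even c" if "(b, x, c) \<in> G" for b x c
  proof -
    from that have "[b * c = x * (v - x)] (mod n)" "odd b" "even x"
      by (auto simp: G_def B_def quadric_fiber_def)
    then have "even (b * c)" using n(2)
      by (metis cong_dvd_iff cong_dvd_modulus even_mult_iff)
    with \<open>odd b\<close> show ?thesis by simp
  qed
  have "F \<union> swap ` G \<subseteq> quadric_odd n v"
    by (auto simp: F_def G_def B_def swap_def quadric_odd_def quadric_def quadric_fiber_def mult.commute)
  moreover have "F \<inter> swap ` G = {}" using cG by (auto simp: F_def B_def swap_def)
  moreover have "card (swap ` G) = card G" by (rule card_image) (auto simp: inj_on_def swap_def)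
  moreover have "finite (quadric_odd n v)"
    by (rule finite_subset[OF _ finite_quadric[of n v]]) (auto simp: quadric_odd_def)
  ultimately have "card F + card G \<le> card (quadric_odd n v)"
    by (metis card_Un_disjoint card_mono finF finG finite_imageI)
  with cardF cardG show ?thesis by (simp add: power2_eq_square)
qed

section \<open>Integer \<open>2 \<times> 2\<close> matrices modulo \<open>n\<close>\<close>

definition mat2 :: "int \<Rightarrow> int \<Rightarrow> int \<Rightarrow> int \<Rightarrow> int ^ 2 ^ 2" where
  "mat2 a b c d = vector [vector [a, b], vector [c, d]]"

lemma mat2_nth [simp]:
  "mat2 a b c d $ 1 $ 1 = a" "mat2 a b c d $ 1 $ 2 = b"
  "mat2 a b c d $ 2 $ 1 = c" "mat2 a b c d $ 2 $ 2 = d"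
  by (simp_all add: mat2_def)

lemma mat2_eq_iff: "M = N \<longleftrightarrow> M $ 1 $ 1 = N $ 1 $ 1 \<and> M $ 1 $ 2 = N $ 1 $ 2 \<and>
    M $ 2 $ 1 = N $ 2 $ 1 \<and> M $ 2 $ 2 = N $ 2 $ 2" for M N :: "int ^ 2 ^ 2"
  by (auto simp: vec_eq_iff forall_2)

lemma matrix_mult_2: "(A ** B) $ i $ j = A $ i $ 1 * B $ 1 $ j + A $ i $ 2 * B $ 2 $ j"
  for A B :: "int ^ 2 ^ 2"
  by (simp add: matrix_matrix_mult_def sum_2)

lemma matrix_vector_mult_2: "(A *v x) $ i = A $ i $ 1 * x $ 1 + A $ i $ 2 * x $ 2"
  for A :: "int ^ 2 ^ 2"
  by (simp add: matrix_vector_mult_def sum_2)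

text \<open>
  Working with integer matrices up to congruence, rather than with reduced representatives,
  makes reduction to several moduli and matrix multiplication compatible without normalisation.
\<close>

definition mat_cong :: "int \<Rightarrow> int ^ 2 ^ 2 \<Rightarrow> int ^ 2 ^ 2 \<Rightarrow> bool" where
  "mat_cong n A B \<longleftrightarrow> (\<forall>i j. [A $ i $ j = B $ i $ j] (mod n))"

definition mat_mod :: "int \<Rightarrow> int ^ 2 ^ 2 \<Rightarrow> int ^ 2 ^ 2" where
  "mat_mod n A = (\<chi> i j. A $ i $ j mod n)"

lemma mat_mod_nth [simp]: "mat_mod n A $ i $ j = A $ i $ j mod n"
  by (simp add: mat_mod_def)

lemma mat_cong_refl: "mat_cong n A A"
  by (simp add: mat_cong_def)

lemma mat_cong_sym: "mat_cong n A B \<Longrightarrow> mat_cong n B A"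
  by (simp add: mat_cong_def cong_sym)

lemma mat_cong_trans: "mat_cong n A B \<Longrightarrow> mat_cong n B C \<Longrightarrow> mat_cong n A C"
  unfolding mat_cong_def by (meson cong_trans)

lemma mat_cong_dvd: "mat_cong n A B \<Longrightarrow> k dvd n \<Longrightarrow> mat_cong k A B"
  unfolding mat_cong_def by (meson cong_dvd_modulus)

lemma mat_cong_mult: "mat_cong n A B \<Longrightarrow> mat_cong n C D \<Longrightarrow> mat_cong n (A ** C) (B ** D)"
  by (simp add: mat_cong_def matrix_mult_2 cong_add cong_mult)

lemma mat_cong_det: "mat_cong n A B \<Longrightarrow> [det A = det B] (mod n)"
  by (simp add: mat_cong_def det_2 cong_diff cong_mult)

lemma mat_cong_mod: "mat_cong n (mat_mod n A) A"
  by (simp add: mat_cong_def)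

lemma mat_cong_coprime_mult:
  "coprime n k \<Longrightarrow> mat_cong n A B \<Longrightarrow> mat_cong k A B \<Longrightarrow> mat_cong (n * k) A B"
  by (simp add: mat_cong_def cong_iff_dvd_diff divides_mult)

lemma mat_cong_residue_eq:
  "mat_cong (int n) A B \<Longrightarrow> A \<in> residue_mat n \<Longrightarrow> B \<in> residue_mat n \<Longrightarrow> A = B"
  unfolding vec_eq_iff
  by (intro allI cong_less_imp_eq_int[where m = "int n"]) (auto simp: mat_cong_def residue_mat_def)

lemma mat_mod_residue: "n > 0 \<Longrightarrow> mat_mod (int n) A \<in> residue_mat n"
  by (simp add: residue_mat_def)

lemma coprime_cong_iff: "[x = y] (mod n) \<Longrightarrow> coprime x n \<longleftrightarrow> coprime y n" for x y n :: int
  by (meson cong_imp_coprime cong_sym)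

lemma mat_mod_GL2:
  assumes "n > 0" "coprime (det A) (int n)"
  shows "mat_mod (int n) A \<in> GL2 n"
  using assms mat_mod_residue[of n A] coprime_cong_iff[OF mat_cong_det[OF mat_cong_mod[of "int n" A]]]
  by (simp add: GL2_def)

lemma finite_residue_mat: "finite (residue_mat n)"
proof (rule finite_imageD)
  let ?f = "\<lambda>M::int^2^2. (M $ 1 $ 1, M $ 1 $ 2, M $ 2 $ 1, M $ 2 $ 2)"
  show "finite (?f ` residue_mat n)"
    by (rule finite_subset[of _ "{0..<int n} \<times> {0..<int n} \<times> {0..<int n} \<times> {0..<int n}"])
      (auto simp: residue_mat_def)
  show "inj_on ?f (residue_mat n)" by (rule inj_onI) (simp add: mat2_eq_iff)
qed

lemma mat_chinese_remainder:
  assumes "coprime n k"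
  obtains C where "mat_cong n C A" "mat_cong k C B"
proof -
  have "\<forall>i j. \<exists>x. [x = A $ i $ j] (mod n) \<and> [x = B $ i $ j] (mod k)"
    using binary_chinese_remainder_int[OF assms] by blast
  then obtain f where "\<forall>i j. [f i j = A $ i $ j] (mod n) \<and> [f i j = B $ i $ j] (mod k)" by metis
  then show ?thesis using that[of "\<chi> i j. f i j"] by (simp add: mat_cong_def)
qed

section \<open>The sign character modulo 2\<close>

text \<open>
  The permutation whose sign is \<^const>\<open>GL2_sign\<close>.
\<close>

definition act2 :: "int ^ 2 ^ 2 \<Rightarrow> int ^ 2 \<Rightarrow> int ^ 2" where
  "act2 M = (\<lambda>v. if v \<in> nonzero_vecs2 then (\<chi> i. (M *v v) $ i mod 2) else v)"

lemma GL2_sign_eq: "GL2_sign M = sign (act2 M)"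
  by (simp add: GL2_sign_def act2_def)

lemma nonzero_vecs2_iff:
  "v \<in> nonzero_vecs2 \<longleftrightarrow> v $ 1 \<in> {0, 1} \<and> v $ 2 \<in> {0, 1} \<and> \<not> (v $ 1 = 0 \<and> v $ 2 = 0)"
  by (auto simp: nonzero_vecs2_def vec_eq_iff forall_2)

lemma nonzero_vecs2_eq: "nonzero_vecs2 = {vector [1, 0], vector [0, 1], vector [1, 1]}"
  by (auto simp: nonzero_vecs2_iff vec_eq_iff forall_2)

lemma act2_cong: "mat_cong 2 A B \<Longrightarrow> act2 A = act2 B"
proof -
  assume AB: "mat_cong 2 A B"
  have "[(A *v v) $ i = (B *v v) $ i] (mod 2)" for v i
    unfolding matrix_vector_mult_2
    by (intro cong_add cong_mult cong_refl) (use AB in \<open>auto simp: mat_cong_def\<close>)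
  then show ?thesis by (simp add: act2_def fun_eq_iff cong_def)
qed

lemma GL2_sign_cong: "mat_cong 2 A B \<Longrightarrow> GL2_sign A = GL2_sign B"
  by (simp add: GL2_sign_eq act2_cong)

lemma act2_closed:
  assumes "odd (det M)" "v \<in> nonzero_vecs2"
  shows "act2 M v \<in> nonzero_vecs2"
proof -
  have "act2 M v $ i = (M $ i $ 1 * v $ 1 + M $ i $ 2 * v $ 2) mod 2" for i
    using assms(2) by (simp add: act2_def matrix_vector_mult_2)
  with assms show ?thesis by (auto simp: nonzero_vecs2_iff det_2 mod2_eq_if)
qed

lemma act2_mult:
  assumes "odd (det B)"
  shows "act2 (A ** B) = act2 A \<circ> act2 B"
proof
  fix v
  show "act2 (A ** B) v = (act2 A \<circ> act2 B) v"
  proof (cases "v \<in> nonzero_vecs2")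
    case True
    then have 1: "act2 A (act2 B v) = (\<chi> i. (A *v act2 B v) $ i mod 2)"
      using act2_closed[OF assms] by (simp add: act2_def[of A])
    have "[(A *v act2 B v) $ i = (A *v (B *v v)) $ i] (mod 2)" for i
      unfolding matrix_vector_mult_2[of A]
      by (intro cong_add cong_mult cong_refl) (use True in \<open>simp_all add: act2_def cong_def\<close>)
    then have 2: "(\<chi> i. (A *v act2 B v) $ i mod 2) = (\<chi> i. (A *v (B *v v)) $ i mod 2)"
      by (simp add: cong_def)
    show ?thesis using 1 2 True by (simp add: act2_def[of "A ** B"] matrix_vector_mul_assoc)
  qed (simp add: act2_def)
qed

lemma act2_one: "act2 (mat 1) = id"
  by (auto simp: act2_def fun_eq_iff nonzero_vecs2_eq vec_eq_iff forall_2)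

text \<open>
  The adjugate of a matrix of odd determinant is its inverse modulo 2.
\<close>

lemma act2_permutation:
  assumes "odd (det M)"
  shows "permutation (act2 M)"
proof -
  let ?adj = "mat2 (M $ 2 $ 2) (- M $ 1 $ 2) (- M $ 2 $ 1) (M $ 1 $ 1)"
  have "mat_cong 2 (M ** ?adj) (mat 1)" "mat_cong 2 (?adj ** M) (mat 1)"
    using assms by (auto simp: mat_cong_def forall_2 matrix_mult_2 mat_def det_2 cong_iff_dvd_diff algebra_simps)
  moreover have "odd (det ?adj)" using assms by (simp add: det_2 mult.commute)
  ultimately have "act2 M \<circ> act2 ?adj = id" "act2 ?adj \<circ> act2 M = id"
    using assms by (metis act2_cong act2_mult act2_one)+
  then have "bij (act2 M)" using o_bij by blast
  moreover have "finite {v. act2 M v \<noteq> v}"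
    by (rule finite_subset[of _ nonzero_vecs2]) (auto simp: act2_def nonzero_vecs2_eq)
  ultimately show ?thesis by (simp add: permutation)
qed

lemma GL2_sign_mult:
  "odd (det A) \<Longrightarrow> odd (det B) \<Longrightarrow> GL2_sign (A ** B) = GL2_sign A * GL2_sign B"
  by (simp add: GL2_sign_eq act2_mult sign_compose act2_permutation)

lemma GL2_sign_values: "GL2_sign M = 1 \<or> GL2_sign M = -1"
  by (simp add: GL2_sign_eq sign_def)

lemma GL2_sign_trivial:
  assumes "odd (det M)" "even (M $ 1 $ 2)" "even (M $ 2 $ 1)"
  shows "GL2_sign M = 1"
proof -
  have "mat_cong 2 M (mat 1)"
    using assms by (auto simp: mat_cong_def forall_2 mat_def det_2 cong_iff_dvd_diff)
  then show ?thesis by (simp add: GL2_sign_eq act2_cong act2_one)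
qed

text \<open>
  These are the three involutions of \<open>GL\<^sub>2(\<int>/2\<int>)\<close>. Each fixes one nonzero vector and
  exchanges the other two.
\<close>

lemma GL2_sign_involution:
  assumes "mat_cong 2 M (mat2 0 1 1 0) \<or> mat_cong 2 M (mat2 1 1 0 1) \<or> mat_cong 2 M (mat2 1 0 1 1)"
  shows "GL2_sign M = -1"
proof -
  let ?p = "vector [1, 0] :: int ^ 2" and ?q = "vector [0, 1] :: int ^ 2"
    and ?r = "vector [1, 1] :: int ^ 2"
  have ne: "?p \<noteq> ?q" "?p \<noteq> ?r" "?q \<noteq> ?r"
    by (auto simp: vec_eq_iff forall_2)
  have act: "act2 (mat2 a b c d) v = vector [(a * v $ 1 + b * v $ 2) mod 2, (c * v $ 1 + d * v $ 2) mod 2]"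
    if "v \<in> nonzero_vecs2" for a b c d v
    using that by (simp add: act2_def vec_eq_iff forall_2 matrix_vector_mult_2)
  have swap: "sign (act2 A) = -1"
    if "act2 A u = v" "act2 A v = u" "act2 A w = w" "u \<noteq> v" "nonzero_vecs2 = {u, v, w}" for A u v w
  proof -
    have "act2 A x = Transposition.transpose u v x" for x
    proof (cases "x \<in> nonzero_vecs2")
      case True
      then have "x = u \<or> x = v \<or> x = w" using that(5) by blast
      then show ?thesis using that(1-4) by (auto simp: Transposition.transpose_def)
    next
      case False
      moreover from False have "x \<noteq> u" "x \<noteq> v" using that(5) by auto
      ultimately show ?thesis by (simp add: act2_def Transposition.transpose_def)
    qed
    then have "act2 A = Transposition.transpose u v" by blast
    with that(4) show ?thesis by (simp add: sign_swap_id)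
  qed
  have mem: "?p \<in> nonzero_vecs2" "?q \<in> nonzero_vecs2" "?r \<in> nonzero_vecs2"
    by (simp_all add: nonzero_vecs2_eq)
  have "sign (act2 (mat2 0 1 1 0)) = -1"
    by (rule swap[of _ ?p ?q ?r]) (simp_all add: act mem ne, auto simp: nonzero_vecs2_eq)
  moreover have "sign (act2 (mat2 1 1 0 1)) = -1"
    by (rule swap[of _ ?q ?r ?p]) (simp_all add: act mem ne, auto simp: nonzero_vecs2_eq)
  moreover have "sign (act2 (mat2 1 0 1 1)) = -1"
    by (rule swap[of _ ?p ?r ?q]) (simp_all add: act mem ne, auto simp: nonzero_vecs2_eq)
  ultimately show ?thesis using assms unfolding GL2_sign_eq by (metis act2_cong)
qed

text \<open>
  An invertible matrix modulo 2 of trace zero has characteristic polynomial \<open>(X - 1)\<^sup>2\<close>, so it is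
  the identity or an involution.
\<close>

lemma GL2_sign_even_trace:
  assumes "odd (det M)" "even (M $ 1 $ 1 + M $ 2 $ 2)" "odd (M $ 1 $ 2) \<or> odd (M $ 2 $ 1)"
  shows "GL2_sign M = -1"
  by (rule GL2_sign_involution)
    (use assms in \<open>auto simp: mat_cong_def forall_2 det_2 cong_iff_dvd_diff\<close>)

text \<open>
  An integer matrix of determinant 1 and sign \<open>-1\<close>: multiplying by it flips the sign modulo 2 and
  preserves determinants modulo every \<open>n\<close>.
\<close>

definition swap_mat :: "int ^ 2 ^ 2" where
  "swap_mat = mat2 0 1 (- 1) 0"

lemma det_swap_mat: "det swap_mat = 1"
  by (simp add: swap_mat_def det_2)

lemma GL2_sign_swap_mat: "GL2_sign swap_mat = -1"
  by (rule GL2_sign_even_trace) (simp_all add: swap_mat_def det_2)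

section \<open>Counting matrices by determinant\<close>

definition unit_residues :: "nat \<Rightarrow> int set" where
  "unit_residues m = {u \<in> {0..<int m}. coprime u (int m)}"

lemma finite_unit_residues: "finite (unit_residues m)"
  by (rule finite_subset[of _ "{0..<int m}"]) (auto simp: unit_residues_def)

lemma card_unit_residues_pos: "m \<ge> 2 \<Longrightarrow> card (unit_residues m) > 0"
  using finite_unit_residues[of m] by (auto simp: card_gt_0_iff unit_residues_def intro!: exI[of _ 1])

lemma mod_unit_residues: "m > 0 \<Longrightarrow> coprime x (int m) \<Longrightarrow> x mod int m \<in> unit_residues m"
  by (simp add: unit_residues_def)

lemma finite_GL2: "finite (GL2 m)"
  by (rule finite_subset[OF _ finite_residue_mat[of m]]) (auto simp: GL2_def)

lemma finite_Psi: "finite (Psi m)"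
  by (rule finite_subset[OF _ finite_GL2[of m]]) (auto simp: Psi_def)

text \<open>
  Given a first row \<open>(a, b)\<close> and one completion \<open>(c\<^sub>0, d\<^sub>0)\<close> of determinant \<open>u\<close>, any completion
  \<open>(c, d)\<close> is determined by the number \<open>d\<^sub>0 c - c\<^sub>0 d\<close> modulo \<open>m\<close>, because \<open>(a, b)\<close> and \<open>(c\<^sub>0, d\<^sub>0)\<close>
  form a basis. So a row has at most \<open>m\<close> completions, and the zero row has none.
\<close>

lemma card_det_fiber_less:
  assumes m: "m \<ge> 2" and u: "coprime u (int m)"
  shows "card {M \<in> residue_mat m. [det M = u] (mod int m)} < m ^ 3"
proof -
  let ?F = "{M \<in> residue_mat m. [det M = u] (mod int m)}"
  let ?R = "{0..<int m}"
  \<comment> \<open>\<open>p a b\<close> is the chosen second row; it is arbitrary when no completion exists.\<close>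
  define p where "p = (\<lambda>a b. SOME q. [a * snd q - b * fst q = u] (mod int m))"
  have p: "[M $ 1 $ 1 * snd (p (M $ 1 $ 1) (M $ 1 $ 2)) - M $ 1 $ 2 * fst (p (M $ 1 $ 1) (M $ 1 $ 2)) = u] (mod int m)"
    if "M \<in> ?F" for M
    unfolding p_def by (rule someI[of _ "(M $ 2 $ 1, M $ 2 $ 2)"]) (use that in \<open>simp add: det_2\<close>)
  define f where "f = (\<lambda>M :: int ^ 2 ^ 2. ((M $ 1 $ 1, M $ 1 $ 2),
    (snd (p (M $ 1 $ 1) (M $ 1 $ 2)) * M $ 2 $ 1 - fst (p (M $ 1 $ 1) (M $ 1 $ 2)) * M $ 2 $ 2) mod int m))"
  have "f ` ?F \<subseteq> (?R \<times> ?R - {(0, 0)}) \<times> ?R"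
  proof
    fix y assume "y \<in> f ` ?F"
    then obtain M where M: "M \<in> ?F" "y = f M" by blast
    have "\<not> (M $ 1 $ 1 = 0 \<and> M $ 1 $ 2 = 0)"
    proof
      assume "M $ 1 $ 1 = 0 \<and> M $ 1 $ 2 = 0"
      with M have "[0 = u] (mod int m)" by (simp add: det_2)
      with u have "coprime 0 (int m)" using coprime_cong_iff by blast
      with m show False by simp
    qed
    with M m show "y \<in> (?R \<times> ?R - {(0, 0)}) \<times> ?R" by (auto simp: f_def residue_mat_def)
  qed
  moreover have "inj_on f ?F"
  proof (rule inj_onI)
    fix M M' assume M: "M \<in> ?F" and M': "M' \<in> ?F" and eq: "f M = f M'"
    define a b where "a = M $ 1 $ 1" and "b = M $ 1 $ 2"
    have ab: "M' $ 1 $ 1 = a" "M' $ 1 $ 2 = b" using eq by (simp_all add: f_def a_def b_def)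
    obtain c0 d0 where p0: "p a b = (c0, d0)" by fastforce
    define c d where "c = M $ 2 $ 1 - M' $ 2 $ 1" and "d = M $ 2 $ 2 - M' $ 2 $ 2"
    have 1: "int m dvd u - (a * d0 - b * c0)"
      using p[OF M] p0 by (simp add: a_def b_def cong_iff_dvd_diff dvd_diff_commute)
    have "int m dvd det M - det M'" using M M' unfolding mod_eq_dvd_iff[symmetric] by (simp add: cong_def)
    moreover have "det M - det M' = a * d - b * c"
      using ab by (simp add: det_2 c_def d_def a_def b_def algebra_simps)
    ultimately have 2: "int m dvd a * d - b * c" by simp
    have "[d0 * M $ 2 $ 1 - c0 * M $ 2 $ 2 = d0 * M' $ 2 $ 1 - c0 * M' $ 2 $ 2] (mod int m)"
      using eq ab p0 by (simp add: f_def cong_def a_def b_def)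
    then have 3: "int m dvd d0 * c - c0 * d"
      by (simp add: cong_iff_dvd_diff c_def d_def algebra_simps)
    \<comment> \<open>Cramer's rule for the basis \<open>(a, b)\<close>, \<open>(c0, d0)\<close>, up to the error in its determinant.\<close>
    have "u * c = (u - (a * d0 - b * c0)) * c + a * (d0 * c - c0 * d) + c0 * (a * d - b * c)"
      "u * d = (u - (a * d0 - b * c0)) * d + b * (d0 * c - c0 * d) + d0 * (a * d - b * c)"
      by (simp_all add: algebra_simps)
    then have "int m dvd u * c" "int m dvd u * d"
      using 1 2 3 by (metis dvd_add dvd_mult dvd_mult2)+
    then have "int m dvd c" "int m dvd d"
      using u by (simp_all add: coprime_dvd_mult_right_iff coprime_commute)
    with ab have "mat_cong (int m) M M'"
      by (simp add: mat_cong_def forall_2 cong_iff_dvd_diff c_def d_def a_def b_def)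
    with M M' show "M = M'" using mat_cong_residue_eq by blast
  qed
  ultimately have "card ?F \<le> card ((?R \<times> ?R - {(0, 0)}) \<times> ?R)"
    by (meson card_inj_on_le finite_Diff finite_SigmaI finite_atLeastLessThan_int)
  also have "\<dots> = (m * m - 1) * m"
    using m by (simp add: card_cartesian_product card_Diff_singleton)
  also have "\<dots> < m * m * m" using m by simp
  finally show ?thesis by (simp add: power3_eq_cube)
qed

lemma card_GL2_less:
  assumes "m \<ge> 2"
  shows "card (GL2 m) < card (unit_residues m) * m ^ 3"
proof -
  let ?F = "\<lambda>u. {M \<in> residue_mat m. [det M = u] (mod int m)}"
  have "GL2 m \<subseteq> (\<Union>u\<in>unit_residues m. ?F u)"
    using assms by (auto simp: GL2_def cong_def intro!: bexI[of _ "det _ mod int m"] mod_unit_residues)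
  then have "card (GL2 m) \<le> card (\<Union>u\<in>unit_residues m. ?F u)"
    by (intro card_mono) (auto simp: finite_unit_residues finite_residue_mat)
  also have "\<dots> \<le> (\<Sum>u\<in>unit_residues m. card (?F u))"
    by (rule card_UN_le[OF finite_unit_residues])
  also have "\<dots> < (\<Sum>u\<in>unit_residues m. m ^ 3)"
    using assms card_unit_residues_pos[OF assms]
    by (intro sum_strict_mono card_det_fiber_less) (auto simp: finite_unit_residues unit_residues_def card_gt_0_iff)
  finally show ?thesis by simp
qed

text \<open>
  The matrix of determinant \<open>u\<close> and trace \<open>1 + u\<close> that corresponds to the point
  \<open>(b, x, c)\<close> of the quadric with parameter \<open>u - 1\<close>.
\<close>

definition eigenvalue_one_mat :: "nat \<Rightarrow> int \<Rightarrow> int \<times> int \<times> int \<Rightarrow> int ^ 2 ^ 2" where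
  "eigenvalue_one_mat m u = (\<lambda>(b, x, c). mat2 ((1 + x) mod int m) b c ((u - x) mod int m))"

lemma inj_on_eigenvalue_one_mat: "inj_on (eigenvalue_one_mat m u) (quadric (int m) v)"
proof (rule inj_onI)
  fix p p' assume "p \<in> quadric (int m) v" "p' \<in> quadric (int m) v"
    and "eigenvalue_one_mat m u p = eigenvalue_one_mat m u p'"
  moreover obtain b x c b' x' c' where p: "p = (b, x, c)" "p' = (b', x', c')" by (metis prod_cases3)
  ultimately have 1: "(b, x, c) \<in> quadric (int m) v" "(b', x', c') \<in> quadric (int m) v"
    and 2: "eigenvalue_one_mat m u (b, x, c) = eigenvalue_one_mat m u (b', x', c')" by auto
  from 2 have "[1 + x = 1 + x'] (mod int m)" by (simp add: eigenvalue_one_mat_def mat2_eq_iff cong_def)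
  then have "[x = x'] (mod int m)" by (simp add: cong_add_lcancel)
  with 1 have "x = x'" by (intro cong_less_imp_eq_int[where m = "int m"]) (auto simp: quadric_def quadric_fiber_def)
  with 2 show "p = p'" by (simp add: p eigenvalue_one_mat_def mat2_eq_iff)
qed

lemma eigenvalue_one_mat_Psi:
  assumes m: "m > 0" and u: "u \<in> unit_residues m" and q: "(b, x, c) \<in> quadric (int m) (u - 1)"
  shows "eigenvalue_one_mat m u (b, x, c) \<in> Psi m"
    and "det (eigenvalue_one_mat m u (b, x, c)) mod int m = u"
proof -
  let ?M = "eigenvalue_one_mat m u (b, x, c)" and ?N = "mat2 (1 + x) b c (u - x)"
  have "mat_cong (int m) ?M ?N"
    by (simp add: mat_cong_def forall_2 eigenvalue_one_mat_def)
  moreover from this have "mat_cong (int m) (mat 1 - ?M) (mat 1 - ?N)"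
    by (simp add: mat_cong_def cong_diff)
  ultimately have det: "[det ?M = det ?N] (mod int m)" "[det (mat 1 - ?M) = det (mat 1 - ?N)] (mod int m)"
    using mat_cong_det by blast+
  have bc: "int m dvd b * c - x * (u - 1 - x)"
    using q by (simp add: quadric_def quadric_fiber_def cong_iff_dvd_diff)
  have "det ?N - u = - (b * c - x * (u - 1 - x))" "det (mat 1 - ?N) = - (b * c - x * (u - 1 - x))"
    by (simp_all add: det_2 mat_def algebra_simps)
  then have "[det ?N = u] (mod int m)" "[det (mat 1 - ?N) = 0] (mod int m)"
    using bc by (simp_all only: cong_iff_dvd_diff dvd_minus_iff diff_zero)
  then have *: "[det ?M = u] (mod int m)" "[det (mat 1 - ?M) = 0] (mod int m)"
    using det cong_trans by blast+
  moreover have "?M \<in> residue_mat m"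
    using m q by (auto simp: residue_mat_def forall_2 eigenvalue_one_mat_def quadric_def quadric_fiber_def)
  ultimately show "?M \<in> Psi m"
    using u coprime_cong_iff[OF *(1)] by (simp add: Psi_def GL2_def unit_residues_def)
  show "det ?M mod int m = u" using *(1) u by (simp add: cong_def unit_residues_def)
qed

lemma card_Psi_by_det:
  assumes "m > 0"
  shows "card {M \<in> Psi m. P M} = (\<Sum>u\<in>unit_residues m. card {M \<in> Psi m. P M \<and> det M mod int m = u})"
proof -
  have "(\<Sum>u\<in>unit_residues m. \<Sum>M\<in>{M \<in> {M \<in> Psi m. P M}. det M mod int m = u}. 1) = (\<Sum>M\<in>{M \<in> Psi m. P M}. 1 :: nat)"
    using assms by (intro sum.group)
      (use finite_Psi[of m] in \<open>auto simp: finite_unit_residues\<close>, auto simp: Psi_def GL2_def intro!: mod_unit_residues)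
  then show ?thesis by (simp add: conj_assoc)
qed

lemma card_Psi_ge:
  assumes "m \<ge> 2"
  shows "card (unit_residues m) * m\<^sup>2 \<le> card (Psi m)"
proof -
  have "m\<^sup>2 \<le> card {M \<in> Psi m. True \<and> det M mod int m = u}" if u: "u \<in> unit_residues m" for u
  proof -
    have "card (quadric (int m) (u - 1)) \<le> card {M \<in> Psi m. True \<and> det M mod int m = u}"
      using assms u eigenvalue_one_mat_Psi[of m u]
      by (intro card_inj_on_le[OF inj_on_eigenvalue_one_mat[of m u]]) (auto simp: finite_Psi)
    moreover have "(int m)\<^sup>2 \<le> int (card (quadric (int m) (u - 1)))"
      using assms by (intro card_quadric_ge) simp
    then have "m\<^sup>2 \<le> card (quadric (int m) (u - 1))" by (simp flip: of_nat_power)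
    ultimately show ?thesis by simp
  qed
  then have "(\<Sum>u\<in>unit_residues m. m\<^sup>2) \<le> card {M \<in> Psi m. True}"
    using card_Psi_by_det[of m "\<lambda>M. True"] assms sum_mono[of "unit_residues m" "\<lambda>_. m\<^sup>2"] by simp
  then show ?thesis by simp
qed

text \<open>
  When \<open>m\<close> is even and \<open>\<beta>\<close> is a quadratic character modulo \<open>m\<close>, this is the kernel of the
  character \<open>sign \<cdot> (\<beta> \<circ> det)\<close>.
\<close>

definition sign_kernel :: "nat \<Rightarrow> (int \<Rightarrow> int) \<Rightarrow> (int ^ 2 ^ 2) set" where
  "sign_kernel m \<beta> = {M \<in> GL2 m. GL2_sign M = \<beta> (det M mod int m)}"

text \<open>
  Right multiplication by \<^const>\<open>swap_mat\<close> injects the sign kernel into its complement.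
\<close>

lemma card_sign_kernel_le:
  assumes m: "m > 0" "even m"
  shows "2 * card (sign_kernel m \<beta>) \<le> card (GL2 m)"
proof -
  let ?f = "\<lambda>M. mat_mod (int m) (M ** swap_mat)"
  have "?f ` sign_kernel m \<beta> \<subseteq> GL2 m - sign_kernel m \<beta>"
  proof
    fix y assume "y \<in> ?f ` sign_kernel m \<beta>"
    then obtain M where M: "M \<in> GL2 m" "GL2_sign M = \<beta> (det M mod int m)" "y = ?f M"
      by (auto simp: sign_kernel_def)
    have cop: "coprime (det M) (int m)" using M by (simp add: GL2_def)
    then have odd: "odd (det M)" using m(2)
      by (metis coprime_common_divisor even_of_nat odd_one)
    have det: "det (M ** swap_mat) = det M" by (simp add: det_mul det_swap_mat)
    have y: "y \<in> GL2 m" unfolding M(3) by (rule mat_mod_GL2) (use m cop det in auto)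
    have "det y mod int m = det M mod int m"
      using mat_cong_det[OF mat_cong_mod[of "int m" "M ** swap_mat"]] det M(3) by (simp add: cong_def)
    moreover have "GL2_sign y = - GL2_sign M"
    proof -
      have "GL2_sign y = GL2_sign (M ** swap_mat)"
        unfolding M(3) by (rule GL2_sign_cong, rule mat_cong_dvd[OF mat_cong_mod]) (use m in simp)
      also have "\<dots> = - GL2_sign M"
        using GL2_sign_mult[of M swap_mat] odd by (simp add: det_swap_mat GL2_sign_swap_mat)
      finally show ?thesis .
    qed
    ultimately have "y \<notin> sign_kernel m \<beta>"
      using M GL2_sign_values[of M] by (auto simp: sign_kernel_def)
    with y show "y \<in> GL2 m - sign_kernel m \<beta>" by blast
  qed
  moreover have "inj_on ?f (sign_kernel m \<beta>)"
  proof (rule inj_onI)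
    fix M M' assume M: "M \<in> sign_kernel m \<beta>" "M' \<in> sign_kernel m \<beta>" and "?f M = ?f M'"
    then have "mat_cong (int m) (M ** swap_mat) (M' ** swap_mat)"
      by (metis mat_cong_mod mat_cong_sym mat_cong_trans)
    then have "mat_cong (int m) M M'"
      by (simp add: mat_cong_def forall_2 matrix_mult_2 swap_mat_def cong_minus_minus_iff)
    with M show "M = M'" by (auto simp: sign_kernel_def GL2_def intro: mat_cong_residue_eq)
  qed
  ultimately have "card (sign_kernel m \<beta>) \<le> card (GL2 m - sign_kernel m \<beta>)"
    by (meson card_inj_on_le finite_Diff finite_GL2)
  moreover have sub: "sign_kernel m \<beta> \<subseteq> GL2 m" by (auto simp: sign_kernel_def)
  then have "card (GL2 m - sign_kernel m \<beta>) = card (GL2 m) - card (sign_kernel m \<beta>)"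
    by (intro card_Diff_subset finite_subset[OF sub finite_GL2])
  moreover have "card (sign_kernel m \<beta>) \<le> card (GL2 m)"
    by (rule card_mono[OF finite_GL2 sub])
  ultimately show ?thesis by linarith
qed

text \<open>
  Determinants with \<open>\<beta> u = 1\<close> contribute at least \<open>m\<^sup>2/4\<close> matrices each and those with
  \<open>\<beta> u = -1\<close> at least \<open>3m\<^sup>2/4\<close>. The two bounds add up to what is needed only because
  both kinds of determinants are equally frequent.
\<close>

lemma card_sign_kernel_Psi_ge:
  assumes m: "m \<ge> 2" "even m"
    and \<beta>: "\<And>u. u \<in> unit_residues m \<Longrightarrow> \<beta> u = 1 \<or> \<beta> u = -1"
    and balanced: "card {u \<in> unit_residues m. \<beta> u = 1} = card {u \<in> unit_residues m. \<beta> u = -1}"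
  shows "card (unit_residues m) * m\<^sup>2 \<le> 2 * card (sign_kernel m \<beta> \<inter> Psi m)"
proof -
  let ?n = "int m" and ?P = "\<lambda>M. GL2_sign M = \<beta> (det M mod int m)"
  let ?U = "\<lambda>s. {u \<in> unit_residues m. \<beta> u = s}"
  let ?c = "\<lambda>u. int (card {M \<in> Psi m. ?P M \<and> det M mod int m = u})"
  have n: "?n > 0" "even ?n" using m by auto
  have fin: "finite {M \<in> Psi m. ?P M \<and> det M mod int m = u}" for u using finite_Psi by simp
  have even_u: "even (u - 1)" if "u \<in> unit_residues m" for u
    using that n(2) unfolding unit_residues_def
    by (metis (no_types, lifting) coprime_common_divisor mem_Collect_eq odd_one odd_even_add even_diff)
  have facts: "odd (det (eigenvalue_one_mat m u (b, x, c)))"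
    "even (eigenvalue_one_mat m u (b, x, c) $ 1 $ 1 + eigenvalue_one_mat m u (b, x, c) $ 2 $ 2)"
    if u: "u \<in> unit_residues m" and q: "(b, x, c) \<in> quadric ?n (u - 1)" for u b x c
  proof -
    have "odd u" using even_u[OF u] by simp
    have "2 dvd ?n" using n by simp
    then have ev: "even (y mod ?n) \<longleftrightarrow> even y" for y by (simp add: dvd_mod_iff)
    show "odd (det (eigenvalue_one_mat m u (b, x, c)))"
      using eigenvalue_one_mat_Psi(2)[OF _ u q] m ev \<open>odd u\<close> by (metis not_numeral_le_zero gr0I)
    show "even (eigenvalue_one_mat m u (b, x, c) $ 1 $ 1 + eigenvalue_one_mat m u (b, x, c) $ 2 $ 2)"
      using \<open>odd u\<close> by (simp add: eigenvalue_one_mat_def ev)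
  qed
  have plus: "?n\<^sup>2 \<le> 4 * ?c u" if u: "u \<in> ?U 1" for u
  proof -
    have img: "eigenvalue_one_mat m u ` quadric_even ?n (u - 1) \<subseteq> {M \<in> Psi m. ?P M \<and> det M mod int m = u}"
    proof safe
      fix b x c assume "(b, x, c) \<in> quadric_even ?n (u - 1)"
      then have q: "(b, x, c) \<in> quadric ?n (u - 1)" and bc: "even b" "even c"
        by (auto simp: quadric_even_def)
      show "eigenvalue_one_mat m u (b, x, c) \<in> Psi m" "det (eigenvalue_one_mat m u (b, x, c)) mod int m = u"
        using eigenvalue_one_mat_Psi q u m by auto
      moreover have "GL2_sign (eigenvalue_one_mat m u (b, x, c)) = 1"
        by (rule GL2_sign_trivial) (use facts(1)[OF _ q] u bc in \<open>auto simp: eigenvalue_one_mat_def\<close>)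
      ultimately show "?P (eigenvalue_one_mat m u (b, x, c))" using u by simp
    qed
    have inj: "inj_on (eigenvalue_one_mat m u) (quadric_even ?n (u - 1))"
      by (rule inj_on_subset[OF inj_on_eigenvalue_one_mat]) (auto simp: quadric_even_def)
    have "card (quadric_even ?n (u - 1)) \<le> card {M \<in> Psi m. ?P M \<and> det M mod int m = u}"
      by (rule card_inj_on_le[OF inj img fin])
    with card_quadric_even_ge[OF n even_u[of u]] u show ?thesis by simp
  qed
  have minus: "3 * ?n\<^sup>2 \<le> 4 * ?c u" if u: "u \<in> ?U (-1)" for u
  proof -
    have img: "eigenvalue_one_mat m u ` quadric_odd ?n (u - 1) \<subseteq> {M \<in> Psi m. ?P M \<and> det M mod int m = u}"
    proof safe
      fix b x c assume "(b, x, c) \<in> quadric_odd ?n (u - 1)"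
      then have q: "(b, x, c) \<in> quadric ?n (u - 1)" and bc: "odd b \<or> odd c"
        by (auto simp: quadric_odd_def)
      show "eigenvalue_one_mat m u (b, x, c) \<in> Psi m" "det (eigenvalue_one_mat m u (b, x, c)) mod int m = u"
        using eigenvalue_one_mat_Psi q u m by auto
      moreover have "GL2_sign (eigenvalue_one_mat m u (b, x, c)) = -1"
      proof (rule GL2_sign_even_trace)
        show "odd (eigenvalue_one_mat m u (b, x, c) $ 1 $ 2) \<or> odd (eigenvalue_one_mat m u (b, x, c) $ 2 $ 1)"
          using bc by (simp add: eigenvalue_one_mat_def)
      qed (use facts[OF _ q] u in auto)
      ultimately show "?P (eigenvalue_one_mat m u (b, x, c))" using u by simp
    qed
    have inj: "inj_on (eigenvalue_one_mat m u) (quadric_odd ?n (u - 1))"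
      by (rule inj_on_subset[OF inj_on_eigenvalue_one_mat]) (auto simp: quadric_odd_def)
    have "card (quadric_odd ?n (u - 1)) \<le> card {M \<in> Psi m. ?P M \<and> det M mod int m = u}"
      by (rule card_inj_on_le[OF inj img fin])
    with card_quadric_odd_ge[OF n even_u[of u]] u show ?thesis by simp
  qed
  have split: "unit_residues m = ?U 1 \<union> ?U (-1)" using \<beta> by auto
  have finU: "finite (?U s)" for s using finite_unit_residues by simp
  have disj: "?U 1 \<inter> ?U (-1) = {}" by auto
  have cardU: "card (unit_residues m) = 2 * card (?U 1)"
    using card_Un_disjoint[OF finU finU disj] split balanced by simp
  have "4 * ?n\<^sup>2 * int (card (?U 1)) = (\<Sum>u\<in>?U 1. ?n\<^sup>2) + (\<Sum>u\<in>?U (-1). 3 * ?n\<^sup>2)"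
    using balanced by (simp add: algebra_simps)
  also have "\<dots> \<le> (\<Sum>u\<in>?U 1. 4 * ?c u) + (\<Sum>u\<in>?U (-1). 4 * ?c u)"
    using plus minus by (intro add_mono sum_mono) blast+
  also have "\<dots> = (\<Sum>u\<in>unit_residues m. 4 * ?c u)"
    using sum.union_disjoint[OF finU finU disj, of "\<lambda>u. 4 * ?c u"] split by simp
  also have "\<dots> = 4 * int (card {M \<in> Psi m. ?P M})"
    using card_Psi_by_det[of m ?P] m by (simp add: sum_distrib_left)
  also have "{M \<in> Psi m. ?P M} = sign_kernel m \<beta> \<inter> Psi m"
    by (auto simp: sign_kernel_def Psi_def)
  finally have "?n\<^sup>2 * int (card (?U 1)) \<le> int (card (sign_kernel m \<beta> \<inter> Psi m))" by simp
  then have "m\<^sup>2 * card (?U 1) \<le> card (sign_kernel m \<beta> \<inter> Psi m)"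
    by (simp flip: of_nat_power of_nat_mult)
  then show ?thesis using cardU by (simp add: algebra_simps)
qed

section \<open>Lifting matrices to the profinite integers\<close>

text \<open>
  Splits \<open>n\<close> into its part composed of primes dividing \<open>N\<close> and its part coprime to \<open>N\<close>.
\<close>

lemma coprime_part_split:
  fixes n N :: nat
  assumes "n > 0"
  shows "\<exists>n1 n2 k. n = n1 * n2 \<and> coprime n2 N \<and> n1 dvd N ^ k"
  using assms
proof (induction n rule: less_induct)
  case (less n)
  show ?case
  proof (cases "coprime n N")
    case True
    then have "n = 1 * n \<and> coprime n N \<and> 1 dvd N ^ 0" by simp
    then show ?thesis by blast
  next
    case False
    define g where "g = gcd n N"
    have "g > 0" "g \<noteq> 1" "g dvd N" using False less.prems by (auto simp: g_def coprime_iff_gcd_eq_1)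
    then have g: "g > 1" "g dvd N" by auto
    obtain h where h: "n = g * h" unfolding g_def by (metis dvdE gcd_dvd1)
    have "h < n" "h > 0" using h g less.prems by auto
    then obtain h1 h2 k where "h = h1 * h2" "coprime h2 N" "h1 dvd N ^ k" using less.IH by blast
    then have "n = (g * h1) * h2 \<and> coprime h2 N \<and> g * h1 dvd N ^ Suc k"
      using h g by (simp add: mult_dvd_mono)
    then show ?thesis by blast
  qed
qed

lemma coprime_dvd_power_right:
  fixes x :: int and n N :: nat
  assumes "coprime x (int N)" "n dvd N ^ k"
  shows "coprime x (int n)"
proof -
  have "int n dvd int N ^ k" using assms(2) by (metis of_nat_dvd_iff of_nat_power)
  moreover have "coprime x (int N ^ k)" using assms(1) by simp
  ultimately show ?thesis by (rule coprime_divisors[OF dvd_refl])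
qed

text \<open>
  Gluing by the Chinese remainder theorem: follow \<open>A\<close> at the primes dividing \<open>N\<close> and \<open>B\<close> at the
  other primes of \<open>n\<close>.
\<close>

lemma matrix_glue:
  fixes n N :: nat and A B :: "int ^ 2 ^ 2"
  assumes "n > 0" "coprime (det A) (int N)" "coprime (det B) (int n)"
  obtains n1 n2 k C where "n = n1 * n2" "coprime n2 N" "n1 dvd N ^ k"
    "mat_cong (int n1) C A" "mat_cong (int n2) C B" "coprime (det C) (int n)"
proof -
  obtain n1 n2 k where n: "n = n1 * n2" "coprime n2 N" "n1 dvd N ^ k"
    using coprime_part_split[OF assms(1), of N] by blast
  have "coprime (N ^ k) n2" using n(2) by (simp add: coprime_commute)
  then have "coprime n1 n2" using n(3) by (meson coprime_divisors dvd_refl)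
  then obtain C where C: "mat_cong (int n1) C A" "mat_cong (int n2) C B"
    using mat_chinese_remainder[of "int n1" "int n2" A B] by auto
  have "coprime (det A) (int n1)" using assms(2) n(3) by (rule coprime_dvd_power_right)
  then have "coprime (det C) (int n1)" using coprime_cong_iff[OF mat_cong_det[OF C(1)]] by simp
  moreover have "coprime (det B) (int n2)" using assms(3) n(1) by simp
  then have "coprime (det C) (int n2)" using coprime_cong_iff[OF mat_cong_det[OF C(2)]] by simp
  ultimately have "coprime (det C) (int n)" using n(1) by simp
  with n C that show ?thesis by blast
qed

lemma dvd_split_parts:
  fixes n1 n2 k1 k2 N :: nat
  assumes "n1 * n2 dvd k1 * k2" "coprime n2 N" "coprime k2 N" "n1 dvd N ^ i" "k1 dvd N ^ j"
  shows "n1 dvd k1" "n2 dvd k2"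
proof -
  have "coprime n1 k2" using assms(3,4) by (meson coprime_commute coprime_divisors coprime_power_right_iff dvd_refl)
  moreover have "n1 dvd k1 * k2" using assms(1) by (rule dvd_mult_left)
  ultimately show "n1 dvd k1" by (simp add: coprime_dvd_mult_left_iff)
  have "coprime n2 k1" using assms(2,5) by (meson coprime_divisors coprime_power_right_iff dvd_refl)
  moreover have "n2 dvd k1 * k2" using assms(1) by (rule dvd_mult_right)
  ultimately show "n2 dvd k2" by (simp add: coprime_dvd_mult_right_iff)
qed

text \<open>
  The lift is \<open>A\<close> at the primes dividing \<open>N\<close> and the identity at all others. Compatibility
  along \<open>n dvd k\<close> holds because each of the two parts of \<open>n\<close> divides the corresponding part of \<open>k\<close>.
\<close>

lemma adelic_lift:
  assumes N: "N > 0" and A: "coprime (det A) (int N)"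
  obtains L where "L \<in> GL2_Zhat" "\<And>n. n > 0 \<Longrightarrow> n dvd N \<Longrightarrow> mat_cong (int n) (L n) A"
proof -
  define glued where "glued = (\<lambda>n C. \<exists>n1 n2 k. n = n1 * n2 \<and> coprime n2 N \<and> n1 dvd N ^ k \<and>
    mat_cong (int n1) C A \<and> mat_cong (int n2) C (mat 1))"
  have "\<exists>C. glued n C \<and> coprime (det C) (int n)" if n: "n > 0" for n
  proof -
    have "coprime (det (mat 1 :: int ^ 2 ^ 2)) (int n)" by simp
    from matrix_glue[OF n A this] show ?thesis unfolding glued_def by metis
  qed
  then obtain C where C: "\<And>n. n > 0 \<Longrightarrow> glued n (C n) \<and> coprime (det (C n)) (int n)" by metis
  define L where "L = (\<lambda>n\<in>{0<..}. mat_mod (int n) (C n))"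
  have GL: "L n \<in> GL2 n" if "n > 0" for n
    using that C[OF that] by (simp add: L_def mat_mod_GL2)
  have parts: "glued n (L n)" if n: "n > 0" for n
  proof -
    obtain n1 n2 k where *: "n = n1 * n2" "coprime n2 N" "n1 dvd N ^ k"
        "mat_cong (int n1) (C n) A" "mat_cong (int n2) (C n) (mat 1)"
      using C[OF n] unfolding glued_def by blast
    have "mat_cong (int n) (L n) (C n)" using n by (simp add: L_def mat_cong_mod)
    then have "mat_cong (int n1) (L n) (C n)" "mat_cong (int n2) (L n) (C n)"
      using *(1) by (meson dvd_triv_left dvd_triv_right mat_cong_dvd of_nat_dvd_iff)+
    with * show ?thesis unfolding glued_def using mat_cong_trans by blast
  qed
  have "mat_cong (int n) (L k) (L n)" if nk: "n > 0" "k > 0" "n dvd k" for n k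
  proof -
    obtain n1 n2 i where n: "n = n1 * n2" "coprime n2 N" "n1 dvd N ^ i"
        "mat_cong (int n1) (L n) A" "mat_cong (int n2) (L n) (mat 1)" using parts[OF nk(1)] unfolding glued_def by blast
    obtain k1 k2 j where k: "k = k1 * k2" "coprime k2 N" "k1 dvd N ^ j"
        "mat_cong (int k1) (L k) A" "mat_cong (int k2) (L k) (mat 1)" using parts[OF nk(2)] unfolding glued_def by blast
    have "n1 dvd k1" "n2 dvd k2"
      using dvd_split_parts[of n1 n2 k1 k2 N i j] n k nk(3) by auto
    then have "mat_cong (int n1) (L k) A" "mat_cong (int n2) (L k) (mat 1)"
      using k mat_cong_dvd by (meson of_nat_dvd_iff)+
    then have "mat_cong (int n1) (L k) (L n)" "mat_cong (int n2) (L k) (L n)"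
      using n mat_cong_sym mat_cong_trans by blast+
    moreover have "coprime (N ^ i) n2" using n(2) by (simp add: coprime_commute)
    then have "coprime n1 n2" using n(3) by (meson coprime_divisors dvd_refl)
    ultimately show ?thesis
      using mat_cong_coprime_mult[of "int n1" "int n2"] n(1) by simp
  qed
  then have "L \<in> GL2_Zhat" using GL by (auto simp: GL2_Zhat_def mat_cong_def L_def)
  moreover have "mat_cong (int n) (L n) A" if n0: "n > 0" "n dvd N" for n
  proof -
    obtain n1 n2 where n: "n = n1 * n2" "coprime n2 N" "mat_cong (int n1) (L n) A"
      using parts[OF n0(1)] unfolding glued_def by blast
    have "n2 dvd N" using n0(2) n(1) by (metis dvd_mult_right)
    then have "n2 = 1" using n(2) by (metis coprime_common_divisor_nat dvd_refl)
    with n show ?thesis by simp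
  qed
  ultimately show ?thesis using that by blast
qed

lemma matrix_lift_coprime:
  assumes N: "N > 0" and m: "m dvd N" and A: "coprime (det A) (int m)"
  obtains C where "mat_cong (int m) C A" "coprime (det C) (int N)"
proof -
  have "coprime (det (mat 1 :: int ^ 2 ^ 2)) (int N)" by simp
  then obtain n1 n2 k C where C: "N = n1 * n2" "coprime n2 m" "mat_cong (int n1) C A" "coprime (det C) (int N)"
    using matrix_glue[OF N A] by metis
  have "m dvd n1" using m C(1,2) by (simp add: coprime_commute coprime_dvd_mult_left_iff)
  then show ?thesis using that C mat_cong_dvd by (meson of_nat_dvd_iff)
qed

lemma int_lift_coprime:
  assumes "N > 0" "m dvd N" "coprime u (int m)"
  obtains w where "[w = u] (mod int m)" "coprime w (int N)"
proof -
  have u: "det (mat2 1 0 0 u) = u" by (simp add: det_2)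
  then have "coprime (det (mat2 1 0 0 u)) (int m)" using assms(3) by simp
  then obtain C where C: "mat_cong (int m) C (mat2 1 0 0 u)" "coprime (det C) (int N)"
    using matrix_lift_coprime[OF assms(1,2)] by blast
  from mat_cong_det[OF C(1)] u have "[det C = u] (mod int m)" by simp
  then show ?thesis using that C(2) by blast
qed

section \<open>The reduction of the Serre subgroup modulo \<open>m\<close>\<close>

text \<open>
  For a Serre curve, \<open>d\<close> is the conductor of the field generated by a square root of the discriminant,
  and \<open>\<alpha>\<close> describes the Galois action on that square root.
\<close>

locale serre_level =
  fixes d m :: nat and \<alpha> :: "int \<Rightarrow> int"
  assumes quadratic: "quadratic_char d \<alpha>"
    and m_ge_2: "m \<ge> 2"
begin

text \<open>
  A common multiple of all the moduli that enter the condition defining the Serre subgroup and the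
  reduction modulo \<open>m\<close>.
\<close>

definition N :: nat where
  "N = 2 * m * d"

text \<open>
  The character of \<open>GL\<^sub>2(\<int>/N\<int>)\<close> whose kernel cuts out the Serre subgroup; multiplicative only on
  matrices whose determinant is coprime to \<open>N\<close>.
\<close>

definition serre_char :: "int ^ 2 ^ 2 \<Rightarrow> int" where
  "serre_char A = GL2_sign A * \<alpha> (det A)"

definition image_mod :: "(int ^ 2 ^ 2) set" where
  "image_mod = reduce_mod m {M \<in> GL2_Zhat. GL2_sign (M 2) = \<alpha> (det (M d))}"

lemma pos: "d > 0" "m > 0" "N > 0"
  using quadratic m_ge_2 by (auto simp: quadratic_char_def N_def)

lemma level_dvd: "m dvd N" "d dvd N" "2 dvd N"
  by (simp_all add: N_def)

lemma coprime_level: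
  assumes "coprime x (int N)"
  shows "coprime x (int m)" "coprime x (int d)" "odd x"
  using assms by (auto simp: N_def coprime_right_2_iff_odd)

lemma alpha_cong: "[x = y] (mod int d) \<Longrightarrow> \<alpha> x = \<alpha> y"
  using quadratic by (simp add: quadratic_char_def)

lemma alpha_values: "coprime x (int N) \<Longrightarrow> \<alpha> x = 1 \<or> \<alpha> x = -1"
  using quadratic coprime_level(2) by (auto simp: quadratic_char_def)

lemma alpha_mult: "coprime x (int N) \<Longrightarrow> coprime y (int N) \<Longrightarrow> \<alpha> (x * y) = \<alpha> x * \<alpha> y"
  using quadratic coprime_level(2) by (auto simp: quadratic_char_def)

lemma alpha_one: "\<alpha> 1 = 1"
  using alpha_mult[of 1 1] alpha_values[of 1] by auto

lemma serre_char_mult: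
  "coprime (det A) (int N) \<Longrightarrow> coprime (det B) (int N) \<Longrightarrow> serre_char (A ** B) = serre_char A * serre_char B"
  by (simp add: serre_char_def GL2_sign_mult coprime_level(3) det_mul alpha_mult)

lemma serre_char_values: "coprime (det A) (int N) \<Longrightarrow> serre_char A = 1 \<or> serre_char A = -1"
  using GL2_sign_values[of A] alpha_values[of "det A"] by (auto simp: serre_char_def)

lemma serre_char_eq_1_iff: "coprime (det A) (int N) \<Longrightarrow> serre_char A = 1 \<longleftrightarrow> GL2_sign A = \<alpha> (det A)"
  using GL2_sign_values[of A] alpha_values[of "det A"] by (auto simp: serre_char_def)

lemma serre_char_cong:
  assumes "mat_cong (int N) A B"
  shows "serre_char A = serre_char B"
proof -
  have "mat_cong (int 2) A B" "mat_cong (int d) A B"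
    using mat_cong_dvd[OF assms] level_dvd by (meson of_nat_dvd_iff)+
  then show ?thesis using GL2_sign_cong alpha_cong mat_cong_det unfolding serre_char_def by fastforce
qed

lemma serre_char_one: "serre_char (mat 1) = 1"
  by (simp add: serre_char_def GL2_sign_eq act2_one alpha_one)

text \<open>
  Profinite matrices can be replaced by integer matrices: restrict to the component at \<open>N\<close> in
  one direction, and apply \<open>adelic_lift\<close> in the other.
\<close>

lemma mem_image_mod_iff:
  "M \<in> image_mod \<longleftrightarrow> M \<in> GL2 m \<and> (\<exists>A. mat_cong (int m) A M \<and> coprime (det A) (int N) \<and> serre_char A = 1)"
proof
  assume "M \<in> image_mod"
  then obtain L where L: "L \<in> GL2_Zhat" "GL2_sign (L 2) = \<alpha> (det (L d))" "M = L m"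
    by (auto simp: image_mod_def reduce_mod_def)
  have GL: "L n \<in> GL2 n" if "n > 0" for n using L(1) that by (auto simp: GL2_Zhat_def)
  have c: "mat_cong (int n) (L N) (L n)" if "n > 0" "n dvd N" for n
    using L(1) that pos(3) by (auto simp: GL2_Zhat_def mat_cong_def)
  have cop: "coprime (det (L N)) (int N)" using GL[OF pos(3)] by (simp add: GL2_def)
  have "GL2_sign (L N) = GL2_sign (L 2)" using GL2_sign_cong c[of 2] level_dvd by simp
  moreover have "\<alpha> (det (L N)) = \<alpha> (det (L d))"
    using alpha_cong mat_cong_det c[of d] level_dvd pos by simp
  ultimately have "serre_char (L N) = 1" using L(2) serre_char_eq_1_iff[OF cop] by simp
  then show "M \<in> GL2 m \<and> (\<exists>A. mat_cong (int m) A M \<and> coprime (det A) (int N) \<and> serre_char A = 1)"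
    using GL[OF pos(2)] c[OF pos(2) level_dvd(1)] cop L(3) by blast
next
  assume "M \<in> GL2 m \<and> (\<exists>A. mat_cong (int m) A M \<and> coprime (det A) (int N) \<and> serre_char A = 1)"
  then obtain A where M: "M \<in> GL2 m" and A: "mat_cong (int m) A M" "coprime (det A) (int N)" "serre_char A = 1"
    by blast
  obtain L where L: "L \<in> GL2_Zhat" "\<And>n. n > 0 \<Longrightarrow> n dvd N \<Longrightarrow> mat_cong (int n) (L n) A"
    using adelic_lift[OF pos(3) A(2)] by blast
  have "GL2_sign (L 2) = GL2_sign A" using GL2_sign_cong L(2)[of 2] level_dvd by simp
  moreover have "\<alpha> (det (L d)) = \<alpha> (det A)"
    using alpha_cong mat_cong_det L(2)[of d] level_dvd pos by simp
  ultimately have "GL2_sign (L 2) = \<alpha> (det (L d))" using A serre_char_eq_1_iff by simp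
  moreover have "L m = M"
  proof (rule mat_cong_residue_eq)
    show "mat_cong (int m) (L m) M"
      using L(2)[OF pos(2) level_dvd(1)] A(1) mat_cong_trans by blast
    show "L m \<in> residue_mat m" "M \<in> residue_mat m"
      using L(1) M pos(2) by (auto simp: GL2_Zhat_def GL2_def)
  qed
  ultimately show "M \<in> image_mod" using L(1) by (auto simp: image_mod_def reduce_mod_def)
qed

lemma image_mod_subset: "image_mod \<subseteq> GL2 m"
  using mem_image_mod_iff by blast

text \<open>
  A lift of \<open>M\<close> on which the character is \<open>-1\<close> is corrected by a factor \<open>W\<close> that is invisible
  modulo \<open>m\<close>.
\<close>

lemma image_mod_full:
  assumes W: "mat_cong (int m) W (mat 1)" "coprime (det W) (int N)" "serre_char W = -1"
  shows "image_mod = GL2 m"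
proof -
  have "M \<in> image_mod" if M: "M \<in> GL2 m" for M
  proof -
    obtain A where A: "mat_cong (int m) A M" "coprime (det A) (int N)"
      using matrix_lift_coprime[OF pos(3) level_dvd(1), of M] M by (auto simp: GL2_def)
    have "mat_cong (int m) (A ** W) (M ** mat 1)" using A W by (intro mat_cong_mult)
    then have "mat_cong (int m) (A ** W) M" by (simp add: matrix_mul_rid)
    moreover have "coprime (det (A ** W)) (int N)" using A W by (simp add: det_mul)
    moreover have "serre_char A = 1 \<or> serre_char (A ** W) = 1" using serre_char_values serre_char_mult A W by fastforce
    ultimately show ?thesis using A M mem_image_mod_iff by blast
  qed
  with image_mod_subset show ?thesis by blast
qed

text \<open>
  For odd \<open>m\<close> the sign modulo 2 can be changed independently of the matrix modulo \<open>m\<close>: glue the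
  identity at the primes of \<open>m\<close> with \<^const>\<open>swap_mat\<close> at the other primes of \<open>N\<close>. The determinant
  stays 1.
\<close>

lemma serre_char_trivial_imp_even:
  assumes triv: "\<And>W. mat_cong (int m) W (mat 1) \<Longrightarrow> coprime (det W) (int N) \<Longrightarrow> serre_char W = 1"
  shows "even m"
proof (rule ccontr)
  assume "odd m"
  have "coprime (det (mat 1 :: int ^ 2 ^ 2)) (int m)" "coprime (det swap_mat) (int N)"
    by (simp_all add: det_I det_swap_mat)
  then obtain n1 n2 k W where W: "N = n1 * n2" "coprime n2 m" "n1 dvd m ^ k"
      "mat_cong (int n1) W (mat 1)" "mat_cong (int n2) W swap_mat" "coprime (det W) (int N)"
    using matrix_glue[OF pos(3)] by metis
  have "m dvd n1" using level_dvd(1) W(1,2) by (simp add: coprime_commute coprime_dvd_mult_left_iff)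
  then have m1: "mat_cong (int m) W (mat 1)" using W(4) mat_cong_dvd by (meson of_nat_dvd_iff)
  have "odd n1" using \<open>odd m\<close> W(3) by (metis dvd_trans even_power)
  then have "even n2" using level_dvd(3) W(1) by simp
  then have "mat_cong 2 W swap_mat" using W(5) mat_cong_dvd by fastforce
  then have "GL2_sign W = -1" using GL2_sign_cong GL2_sign_swap_mat by simp
  moreover have "coprime (m ^ k) n2" using W(2) by (simp add: coprime_commute)
  then have "coprime n1 n2" using W(3) by (meson coprime_divisors dvd_refl)
  have "[det W = 1] (mod int n1)" "[det W = 1] (mod int n2)"
    using mat_cong_det[OF W(4)] mat_cong_det[OF W(5)] by (simp_all add: det_I det_swap_mat)
  then have "[det W = 1] (mod int N)"
    using \<open>coprime n1 n2\<close> W(1) by (simp add: coprime_cong_mult)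
  then have "[det W = 1] (mod int d)" using level_dvd(2) by (meson cong_dvd_modulus of_nat_dvd_iff)
  then have "\<alpha> (det W) = 1" using alpha_cong alpha_one by simp
  ultimately have "serre_char W = -1" by (simp add: serre_char_def)
  with triv[OF m1 W(6)] show False by simp
qed

lemma inverse_mod_level:
  assumes B: "coprime (det B) (int N)"
  obtains B' where "mat_cong (int N) (B ** B') (mat 1)" "coprime (det B') (int N)"
proof -
  obtain x where x: "[det B * x = 1] (mod int N)" using cong_solve_coprime_int[OF B] by blast
  let ?B' = "mat2 (x * B $ 2 $ 2) (- x * B $ 1 $ 2) (- x * B $ 2 $ 1) (x * B $ 1 $ 1)"
  have inv: "mat_cong (int N) (B ** ?B') (mat 1)"
    using x by (simp add: mat_cong_def forall_2 matrix_mult_2 mat_def det_2 algebra_simps)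
  have "[det B * det ?B' = 1] (mod int N)" using mat_cong_det[OF inv] by (simp add: det_mul)
  then have "coprime (det B * det ?B') (int N)" by (metis coprime_1_left coprime_cong_iff)
  then have "coprime (det ?B') (int N)" by simp
  with inv that show ?thesis by blast
qed

lemma serre_char_cong_level:
  assumes triv: "\<And>W. mat_cong (int m) W (mat 1) \<Longrightarrow> coprime (det W) (int N) \<Longrightarrow> serre_char W = 1"
    and A: "coprime (det A) (int N)" and B: "coprime (det B) (int N)" and AB: "mat_cong (int m) A B"
  shows "serre_char A = serre_char B"
proof -
  obtain B' where B': "mat_cong (int N) (B ** B') (mat 1)" "coprime (det B') (int N)"
    using inverse_mod_level[OF B] by blast
  have "mat_cong (int m) (A ** B') (B ** B')" using AB by (intro mat_cong_mult mat_cong_refl)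
  moreover have "mat_cong (int m) (B ** B') (mat 1)" using B' level_dvd(1) mat_cong_dvd by (meson of_nat_dvd_iff)
  ultimately have "mat_cong (int m) (A ** B') (mat 1)" using mat_cong_trans by blast
  then have "serre_char (A ** B') = 1" using triv A B' by (simp add: det_mul)
  moreover have "serre_char (B ** B') = 1" using serre_char_cong[OF B'(1)] serre_char_one by simp
  ultimately have "serre_char A * serre_char B' = serre_char B * serre_char B'" using A B B' by (simp add: serre_char_mult)
  moreover have "serre_char B' \<noteq> 0" using serre_char_values[OF B'(2)] by auto
  ultimately show ?thesis by simp
qed

text \<open>
  The value of \<open>\<alpha>\<close> at a lift of \<open>u\<close> to a unit modulo \<open>N\<close>. It is independent of the lift
  when the character is trivial on matrices that are the identity modulo \<open>m\<close>.
\<close>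

definition level_char :: "int \<Rightarrow> int" where
  "level_char u = \<alpha> (SOME w. [w = u] (mod int m) \<and> coprime w (int N))"

context
  assumes triv: "\<And>W. mat_cong (int m) W (mat 1) \<Longrightarrow> coprime (det W) (int N) \<Longrightarrow> serre_char W = 1"
begin

text \<open>
  Diagonal matrices \<open>diag (1, w)\<close> have trivial sign, so the character restricted to them is \<open>\<alpha>\<close>.
\<close>

lemma alpha_cong_level:
  assumes w: "coprime w (int N)" "coprime w' (int N)" "[w = w'] (mod int m)"
  shows "\<alpha> w = \<alpha> w'"
proof -
  have chi: "serre_char (mat2 1 0 0 z) = \<alpha> z" if "coprime z (int N)" for z
    using coprime_level(3)[OF that] by (simp add: serre_char_def GL2_sign_trivial det_2)
  have "mat_cong (int m) (mat2 1 0 0 w) (mat2 1 0 0 w')"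
    using w(3) by (simp add: mat_cong_def forall_2)
  then have "serre_char (mat2 1 0 0 w) = serre_char (mat2 1 0 0 w')"
    using w by (intro serre_char_cong_level[OF triv]) (auto simp: det_2)
  with w chi show ?thesis by simp
qed

lemma level_char_eq:
  assumes "coprime w (int N)" "[w = u] (mod int m)"
  shows "level_char u = \<alpha> w"
proof -
  let ?w = "SOME w. [w = u] (mod int m) \<and> coprime w (int N)"
  have "[?w = u] (mod int m) \<and> coprime ?w (int N)" by (rule someI[of _ w]) (use assms in auto)
  then show ?thesis unfolding level_char_def using assms alpha_cong_level cong_sym cong_trans by blast
qed

lemma level_char_values: "u \<in> unit_residues m \<Longrightarrow> level_char u = 1 \<or> level_char u = -1"
  using int_lift_coprime[OF pos(3) level_dvd(1), of u] level_char_eq alpha_values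
  unfolding unit_residues_def by (metis (mono_tags, lifting) mem_Collect_eq)

lemma image_mod_eq_sign_kernel: "image_mod = sign_kernel m level_char"
proof -
  have "M \<in> image_mod \<longleftrightarrow> GL2_sign M = level_char (det M mod int m)" if M: "M \<in> GL2 m" for M
  proof -
    have ev: "even m" by (rule serre_char_trivial_imp_even[OF triv])
    have *: "GL2_sign A = GL2_sign M" "level_char (det M mod int m) = \<alpha> (det A)"
      if A: "mat_cong (int m) A M" "coprime (det A) (int N)" for A
    proof -
      show "GL2_sign A = GL2_sign M"
        by (rule GL2_sign_cong, rule mat_cong_dvd[OF A(1)]) (use ev in simp)
      have "[det A = det M mod int m] (mod int m)"
        using mat_cong_det[OF A(1)] by (simp add: cong_def)
      then show "level_char (det M mod int m) = \<alpha> (det A)" using level_char_eq A(2) by blast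
    qed
    obtain A where A: "mat_cong (int m) A M" "coprime (det A) (int N)"
      using matrix_lift_coprime[OF pos(3) level_dvd(1), of M] M by (auto simp: GL2_def)
    show ?thesis
    proof
      assume "M \<in> image_mod"
      then obtain A' where "mat_cong (int m) A' M" "coprime (det A') (int N)" "serre_char A' = 1"
        using mem_image_mod_iff by blast
      then show "GL2_sign M = level_char (det M mod int m)" using * serre_char_eq_1_iff by metis
    next
      assume "GL2_sign M = level_char (det M mod int m)"
      then have "serre_char A = 1" using * A serre_char_eq_1_iff by metis
      with A M show "M \<in> image_mod" using mem_image_mod_iff by blast
    qed
  qed
  then show ?thesis using image_mod_subset by (auto simp: sign_kernel_def)
qed

text \<open>
  The character \<open>\<alpha>\<close> takes the value \<open>-1\<close> at some \<open>t\<close> coprime to \<open>N\<close>, and multiplication by \<open>t\<close>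
  exchanges the two value classes.
\<close>

lemma level_char_balanced:
  "card {u \<in> unit_residues m. level_char u = 1} = card {u \<in> unit_residues m. level_char u = -1}"
proof -
  obtain x where x: "coprime x (int d)" "\<alpha> x = -1"
    using quadratic by (auto simp: quadratic_char_def)
  obtain t where t: "[t = x] (mod int d)" "coprime t (int N)"
    using int_lift_coprime[OF pos(3) level_dvd(2) x(1)] by blast
  have alpha_t: "\<alpha> t = -1" using alpha_cong[OF t(1)] x(2) by simp
  let ?f = "\<lambda>u. u * t mod int m"
  have flip: "?f u \<in> unit_residues m \<and> level_char (?f u) = - level_char u" if u: "u \<in> unit_residues m" for u
  proof -
    obtain w where w: "[w = u] (mod int m)" "coprime w (int N)"
      using int_lift_coprime[OF pos(3) level_dvd(1), of u] u by (auto simp: unit_residues_def)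
    have "coprime (u * t) (int m)" using u coprime_level(1)[OF t(2)] by (simp add: unit_residues_def)
    then have "?f u \<in> unit_residues m" using pos(2) by (rule mod_unit_residues[rotated])
    moreover have "[w * t = ?f u] (mod int m)" using cong_mult[OF w(1) cong_refl[of t]] by (simp add: cong_def)
    then have "level_char (?f u) = \<alpha> (w * t)" using w t by (intro level_char_eq) auto
    then have "level_char (?f u) = - level_char u" using w t alpha_t level_char_eq alpha_mult by simp
    ultimately show ?thesis by blast
  qed
  have inj: "inj_on ?f (unit_residues m)"
  proof (rule inj_onI)
    fix u v assume uv: "u \<in> unit_residues m" "v \<in> unit_residues m" "?f u = ?f v"
    then have "[u * t = v * t] (mod int m)" by (simp add: cong_def)
    then have "[u = v] (mod int m)"
      using coprime_level(1)[OF t(2)] by (simp add: cong_mult_rcancel coprime_commute)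
    with uv show "u = v" by (intro cong_less_imp_eq_int[where m = "int m"]) (auto simp: unit_residues_def)
  qed
  have le: "card {u \<in> unit_residues m. level_char u = s} \<le> card {u \<in> unit_residues m. level_char u = - s}" for s
    by (rule card_inj_on_le[of ?f])
      (use flip inj finite_unit_residues in \<open>auto intro: inj_on_subset\<close>)
  show ?thesis using le[of 1] le[of "-1"] by simp
qed

end

text \<open>
  Both cases compare with \<open>\<phi>(m) m\<^sup>3\<close>, where \<open>\<phi>(m)\<close> is the number of unit residues; in the index two
  case both sides are halved.
\<close>

theorem card_image_mod_less: "card image_mod < m * card (image_mod \<inter> Psi m)"
proof (cases "\<exists>W. mat_cong (int m) W (mat 1) \<and> coprime (det W) (int N) \<and> serre_char W = -1")
  case True
  then have full: "image_mod = GL2 m" using image_mod_full by blast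
  have "card (GL2 m) < card (unit_residues m) * m ^ 3" using m_ge_2 by (rule card_GL2_less)
  also have "\<dots> = m * (card (unit_residues m) * m\<^sup>2)" by (simp add: power3_eq_cube power2_eq_square)
  also have "\<dots> \<le> m * card (Psi m)" using card_Psi_ge[OF m_ge_2] by (rule mult_le_mono2)
  also have "Psi m = image_mod \<inter> Psi m" using full by (auto simp: Psi_def)
  finally show ?thesis using full by simp
next
  case False
  then have triv: "\<And>W. mat_cong (int m) W (mat 1) \<Longrightarrow> coprime (det W) (int N) \<Longrightarrow> serre_char W = 1"
    using serre_char_values by blast
  have ev: "even m" using triv by (rule serre_char_trivial_imp_even)
  have eq: "image_mod = sign_kernel m level_char" using triv by (rule image_mod_eq_sign_kernel)
  have "2 * card image_mod \<le> card (GL2 m)" unfolding eq using pos(2) ev by (rule card_sign_kernel_le)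
  also have "\<dots> < card (unit_residues m) * m ^ 3" using m_ge_2 by (rule card_GL2_less)
  also have "\<dots> = m * (card (unit_residues m) * m\<^sup>2)" by (simp add: power3_eq_cube power2_eq_square)
  also have "\<dots> \<le> m * (2 * card (image_mod \<inter> Psi m))"
    unfolding eq using m_ge_2 ev level_char_values[OF triv] level_char_balanced[OF triv]
    by (intro mult_le_mono2 card_sign_kernel_Psi_ge) blast+
  finally show ?thesis by simp
qed

end

theorem corollary4:
  fixes a b :: int and e :: "nat \<Rightarrow> ec_point \<times> ec_point" and m :: nat
  assumes "tate_basis a b e"
    and "serre_curve a b e"
    and "m \<ge> 2"
  shows "C_mdiv a e m > 1 / real m"
proof -
  obtain \<alpha> where \<alpha>: "disc_char a b \<alpha>" "adelic_image a e = serre_subgroup a b \<alpha>"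
    using assms(2) by (auto simp: serre_curve_def)
  interpret serre_level "disc_conductor a b" m \<alpha>
    using \<alpha>(1) assms(3) by unfold_locales (auto simp: disc_char_def)
  have image: "reduce_mod m (adelic_image a e) = image_mod"
    by (simp add: \<alpha>(2) serre_subgroup_def image_mod_def)
  have less: "card image_mod < m * card (image_mod \<inter> Psi m)" by (rule card_image_mod_less)
  have "finite image_mod" using finite_subset[OF image_mod_subset finite_GL2] .
  then have "card (image_mod \<inter> Psi m) \<le> card image_mod" by (intro card_mono) auto
  with less have pos: "card image_mod > 0" by (cases "card image_mod") auto
  have "real (card image_mod) < real m * real (card (image_mod \<inter> Psi m))"
    using less by (simp flip: of_nat_mult)
  with pos show ?thesis using assms(3) by (simp add: C_mdiv_def image field_simps)
qed

end
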